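(* Let $\mathcal X$ be a real Hilbert space, let $f\colon\mathcal X\to\mathbb R$ be convex and differentiable with a gradient $\nabla f\colon\mathcal X\to\mathcal X$ that is Lipschitz continuous with constant $\beta^{-1}$ for some $\beta>0$, and let $g\colon\mathcal X\to\mathbb R\cup\{\pm\infty\}$ be proper, convex and lower semi-continuous (not necessarily differentiable). Let $x_0\in\mathcal X$, let $(\gamma_n)_{n\ge0}$ be real numbers with $0<\gamma_n<2\beta$ for all $n\ge 0$, let $(\alpha^{(1)}_n)_{n\ge0}$ and $(\alpha^{(2)}_n)_{n\ge0}$ be sequences of real numbers, and let $(x_n)_{n\ge0}$, $(w_n)_{n\ge0}$, $(\Delta x_n^1)_{n\ge0}$, $(\Delta x_n^2)_{n\ge0}$ be sequences in $\mathcal X$ (here the superscripts $1,2$ are indices) such that for all $n\ge0$ $$w_n = x_n+\Delta x_n^1,\qquad x_{n+1}=\mathrm{Prox}^{\gamma_n}_{g}\left(x_n-\gamma_n\nabla f(w_n)+\frac{\gamma_n}{\beta}\Delta x_n^1+\Delta x_n^2\right),$$ and such that for all $n\ge1$ $$\frac{1}{2\beta}\|\Delta x_n^1\|^2+\frac{\beta}{2\gamma_n(2\beta-\gamma_n)}\|\Delta x_n^2\|^2\le \frac{\alpha^{(1)}_n(2\beta-\gamma_{n-1})}{2\beta\gamma_{n-1}}\left\|x_n-x_{n-1}-\frac{\beta}{2\beta-\gamma_{n-1}}\Delta x_{n-1}^2\right\|^2+\frac{\beta\alpha^{(2)}_n}{2}\left\|\nabla f(w_n)-\nabla f(w_{n-1})-\frac1\beta(x_n-w_{n-1})\right\|^2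 .$$ Then the following hold. 1. For $n\ge0$ define $$V_n = f(w_n)+g(x_{n+1})+\langle\nabla f(w_n),x_{n+1}-w_n\rangle+\frac1{2\beta}\|x_{n+1}-w_n\|^2 .$$ Then $V_n\ge f(x_{n+1})+g(x_{n+1})$ for all $n\ge0$, and if $\alpha^{(1)}_n\le1$ and $\alpha^{(2)}_n\le 1$ for all $n\ge0$, the sequence $$\left(V_n+\frac{2\beta-\gamma_n}{2\beta\gamma_n}\left\|x_{n+1}-x_n-\frac{\beta}{2\beta-\gamma_n}\Delta x_n^2\right\|^2\right)_{n\ge0}$$ is monotonically non-increasing. 2. If $f+g$ is bounded from below and $$0<\liminf_{n\to\infty}\gamma_n\le\limsup_{n\to\infty}\gamma_n<2\beta,\qquad 0\le\limsup_{n\to\infty}\alpha^{(1)}_n<1,\qquad 0\le\limsup_{n\to\infty}\alpha^{(2)}_n<1,$$ then $$\sum_{n=0}^\infty\|x_n-x_{n+1}\|^2<+\infty,\qquad \sum_{n=0}^\infty\|\Delta x_n^1\|^2<+\infty,\qquad \sum_{n=0}^\infty\|\Delta x_n^2\|^2<+\infty .$$ 3. Under the conditions of item 2, any weak sequential cluster point of $(x_n)_{n\ge0}$ is a minimizer of $f+g$. If $f+g$ has no minimizers, then $\|x_n\|\to+\infty$ as $n\to\infty$. Conversely, a weak sequential cluster point of $(x_n)_{n\ge 0}$ exists whenever the sequence $(x_n)_{n\ge0}$ is bounded.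
   Context: $\langle\cdot,\cdot\rangle$ and $\|\cdot\|$ denote the inner product and induced norm of $\mathcal X$. Differentiable means Fréchet differentiable, with the derivative identified with the gradient $\nabla f$. A function $g\colon\mathcal X\to\mathbb R\cup\{\pm\infty\}$ is proper if it never takes the value $-\infty$ and $\operatorname{dom} g=\{x\in\mathcal X: g(x)<+\infty\}$ is nonempty. For $g$ proper, convex and lower semi-continuous, $x\in\mathcal X$ and step-size $\gamma>0$, the proximal point is the unique minimizer $$\mathrm{Prox}^{\gamma}_{g}(x)=\arg\min_{z\in\mathcal X}\left\{g(z)+\frac1{2\gamma}\|z-x\|^2\right\}.$$ A weak sequential cluster point of a sequence is the weak limit of some subsequence. *)

theory Defs
  imports "HOL-Analysis.Analysis"
begin

definition proper_fun :: "('a \<Rightarrow> ereal) \<Rightarrow> bool" where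
  "proper_fun g \<longleftrightarrow> (\<forall>x. g x \<noteq> -\<infinity>) \<and> {x. g x < \<infinity>} \<noteq> {}"

text \<open>
  Convexity of an extended-real-valued function is convexity of its epigraph; this avoids
  any convention for \<open>\<infinity> - \<infinity>\<close> and \<open>0 * \<infinity>\<close>.
\<close>

definition convex_fun :: "('a::real_vector \<Rightarrow> ereal) \<Rightarrow> bool" where
  "convex_fun g \<longleftrightarrow> convex {(x, r::real). g x \<le> ereal r}"

definition lsc_fun :: "('a::topological_space \<Rightarrow> ereal) \<Rightarrow> bool" where
  "lsc_fun g \<longleftrightarrow> (\<forall>x. g x \<le> Liminf (nhds x) g)"

abbreviation minimizer :: "('a \<Rightarrow> ereal) \<Rightarrow> 'a \<Rightarrow> bool" where
  "minimizer h \<equiv> is_arg_min h (\<lambda>_. True)"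

text \<open>
  The description operator is meaningful only when the minimizer exists and is unique, as it is
  for a proper, convex, lower semi-continuous \<open>g\<close> on a Hilbert space and \<open>\<gamma> > 0\<close>.
\<close>

definition prox :: "real \<Rightarrow> ('a::real_inner \<Rightarrow> ereal) \<Rightarrow> 'a \<Rightarrow> 'a" where
  "prox \<gamma> g x = (THE p. minimizer (\<lambda>z. g z + ereal (1 / (2 * \<gamma>) * (norm (z - x))\<^sup>2)) p)"

definition weakly_converges :: "(nat \<Rightarrow> 'a::real_inner) \<Rightarrow> 'a \<Rightarrow> bool" where
  "weakly_converges u l \<longleftrightarrow> (\<forall>y. (\<lambda>n. u n \<bullet> y) \<longlonglongrightarrow> l \<bullet> y)"

definition weak_seq_cluster_point :: "(nat \<Rightarrow> 'a::real_inner) \<Rightarrow> 'a \<Rightarrow> bool" where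
  "weak_seq_cluster_point u l \<longleftrightarrow> (\<exists>r::nat \<Rightarrow> nat. strict_mono r \<and> weakly_converges (u \<circ> r) l)"

definition lyapunov ::
  "real \<Rightarrow> ('a::real_inner \<Rightarrow> real) \<Rightarrow> ('a \<Rightarrow> 'a) \<Rightarrow> ('a \<Rightarrow> ereal)
     \<Rightarrow> (nat \<Rightarrow> 'a) \<Rightarrow> (nat \<Rightarrow> 'a) \<Rightarrow> nat \<Rightarrow> ereal" where
  "lyapunov \<beta> f gradf g x w n =
     ereal (f (w n)) + g (x (Suc n)) + ereal (gradf (w n) \<bullet> (x (Suc n) - w n))
       + ereal (1 / (2 * \<beta>) * (norm (x (Suc n) - w n))\<^sup>2)"

end

theory Submission
  imports Defs "HOL-Library.Diagonal_Subsequence"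
begin

text \<open>
  Let \<open>R\<^sub>n\<close> and \<open>Q\<^sub>n\<close> be the two nonnegative terms on the right of the deviation bound at index
  \<open>n + 1\<close>, without their factors \<open>\<alpha>\<close>. The subgradient inequality at the proximal point and the
  inequality \<open>f x + \<langle>\<nabla>f x, y - x\<rangle> + \<beta>/2 \<parallel>\<nabla>f y - \<nabla>f x\<parallel>\<^sup>2 \<le> f y\<close> combine, after completing two squares,
  to \<open>V\<^sub>n\<^sub>+\<^sub>1 + R\<^sub>n\<^sub>+\<^sub>1 + Q\<^sub>n \<le> V\<^sub>n + d\<^sub>n\<^sub>+\<^sub>1\<close>, where \<open>d\<close> is the left side of the deviation bound. Hence
  \<open>V + R\<close> decreases by at least \<open>(1 - \<alpha>1) R\<^sub>n + (1 - \<alpha>2) Q\<^sub>n\<close>, which makes \<open>R\<close>, \<open>Q\<close> and then \<open>d\<close>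
  summable. So subgradients of \<open>f + g\<close> at the iterates tend to zero in norm, and weak cluster points
  are minimizers. Projections and Riesz vectors are obtained as proximal points.
\<close>

section \<open>Convex lower semi-continuous functions and the proximal map\<close>

lemma lsc_fun_iff: "lsc_fun g \<longleftrightarrow> (\<forall>x y. y < g x \<longrightarrow> (\<forall>\<^sub>F a in nhds x. y < g a))"
  by (auto simp: lsc_fun_def le_Liminf_iff)

text \<open>Otherwise some \<open>y\<close> lies strictly between \<open>l\<close> and
  \<open>g p\<close>; eventually \<open>g (z n)\<close> exceeds \<open>y\<close> while
  \<open>v n\<close> is below it. The bounds \<open>v n\<close> are real, so the result applies to
  minimizing sequences and to sublevel sets with a moving level alike.\<close>

lemma lsc_fun_sequentially:
  fixes g :: "'a::topological_space \<Rightarrow> ereal"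
  assumes lsc: "lsc_fun g"
    and z: "z \<longlonglongrightarrow> p" and v: "v \<longlonglongrightarrow> l"
    and le: "\<And>n. g (z n) \<le> ereal (v n)"
  shows "g p \<le> ereal l"
proof (rule ccontr)
  assume "\<not> g p \<le> ereal l"
  then obtain y where y: "ereal l < y" "y < g p"
    using dense by (meson not_le)
  have "eventually (\<lambda>a. y < g a) (nhds p)"
    using lsc y(2) by (simp add: lsc_fun_iff)
  then have "\<forall>\<^sub>F n in sequentially. y < g (z n)"
    using z by (rule eventually_compose_filterlim)
  moreover have "\<forall>\<^sub>F n in sequentially. ereal (v n) < y"
    using y(1) v by (intro order_tendstoD(2)[where y = "ereal l"]) auto
  ultimately have "\<forall>\<^sub>F n in sequentially. False"
    by eventually_elim (use le in \<open>meson less_le_trans less_asym\<close>)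
  then show False by simp
qed

lemma convex_funD:
  assumes "convex_fun g" "g a \<le> ereal r" "g b \<le> ereal s" "0 \<le> t" "t \<le> 1"
  shows "g ((1 - t) *\<^sub>R a + t *\<^sub>R b) \<le> ereal ((1 - t) * r + t * s)"
  using convexD[of "{(x, r::real). g x \<le> ereal r}" "(a, r)" "(b, s)" "1 - t" t] assms
  by (auto simp: convex_fun_def)

text \<open>
  Lower semi-continuity bounds \<open>g\<close> from below near a point of its domain; convexity
  propagates this bound to the whole space, with linear growth.
\<close>

lemma convex_lsc_lower_bound:
  fixes g :: "'a::real_inner \<Rightarrow> ereal"
  assumes cvx: "convex_fun g" and lsc: "lsc_fun g" and a: "g a = ereal ga"
  obtains L where "L \<ge> 0" "\<And>z r. g z \<le> ereal r \<Longrightarrow> ga - 1 - L * norm (z - a) \<le> r"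
proof -
  have "ereal (ga - 1) < g a" using a by simp
  then have "eventually (\<lambda>z. ereal (ga - 1) < g z) (nhds a)"
    using lsc by (simp add: lsc_fun_iff)
  then obtain d where d: "d > 0" "\<And>z. dist z a < d \<Longrightarrow> ereal (ga - 1) < g z"
    unfolding eventually_nhds_metric by blast
  have "ga - 1 - 2 / d * norm (z - a) \<le> r" if z: "g z \<le> ereal r" for z r
  proof (cases "dist z a < d")
    case True
    then have "ereal (ga - 1) < ereal r" using d(2)[OF True] z by (meson less_le_trans)
    moreover have "2 / d * norm (z - a) \<ge> 0" using d by simp
    ultimately show ?thesis by simp
  next
    case False
    define R where "R = norm (z - a)"
    have R: "R \<ge> d" using False by (simp add: R_def dist_norm)
    \<comment> \<open>This \<open>t\<close> moves the point to distance \<open>d / 2\<close> from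
      \<open>a\<close>, inside the ball where the local bound holds; \<open>1 / t\<close> is then
      the slope \<open>2 / d\<close> times \<open>R\<close>.\<close>
    define t where "t = d / (2 * R)"
    have t: "0 < t" "t \<le> 1" "t * R < d" using R d by (auto simp: t_def field_simps)
    have eq: "(1 - t) *\<^sub>R a + t *\<^sub>R z - a = t *\<^sub>R (z - a)" by (simp add: algebra_simps)
    have "dist ((1 - t) *\<^sub>R a + t *\<^sub>R z) a < d"
      unfolding dist_norm eq using t by (simp add: R_def)
    from d(2)[OF this] have "ereal (ga - 1) < g ((1 - t) *\<^sub>R a + t *\<^sub>R z)" .
    also have "\<dots> \<le> ereal ((1 - t) * ga + t * r)"
      using convex_funD[OF cvx _ z, of a ga t] a t by simp
    finally have "t * (ga - r) < 1" by (simp add: algebra_simps)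
    then have "ga - r < 1 / t" using t by (simp add: field_simps)
    also have "1 / t = 2 / d * R" using R d by (simp add: t_def)
    finally show ?thesis using R_def by simp
  qed
  then show ?thesis using that[of "2 / d"] d by simp
qed

text \<open>
  A minimizing sequence of \<open>g + k \<parallel>\<cdot> - x\<parallel>\<^sup>2\<close> is Cauchy by the parallelogram law.
\<close>

lemma exists_regularized_minimizer:
  fixes g :: "'a::{real_inner, complete_space} \<Rightarrow> ereal"
  assumes pr: "proper_fun g" and cvx: "convex_fun g" and lsc: "lsc_fun g" and k: "k > 0"
  obtains p b where "g p = ereal b"
    "\<And>z s. g z \<le> ereal s \<Longrightarrow> b + k * (norm (p - x))\<^sup>2 \<le> s + k * (norm (z - x))\<^sup>2"
proof -
  obtain a where "g a < \<infinity>" using pr by (auto simp: proper_fun_def)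
  moreover have "g a \<noteq> -\<infinity>" using pr by (auto simp: proper_fun_def)
  ultimately obtain ga where ga: "g a = ereal ga" by (cases "g a") auto
  obtain L where L: "L \<ge> 0" "\<And>z r. g z \<le> ereal r \<Longrightarrow> ga - 1 - L * norm (z - a) \<le> r"
    using convex_lsc_lower_bound[OF cvx lsc ga] by blast
  define q where "q z = k * (norm (z - x))\<^sup>2" for z
  \<comment> \<open>Real heights over the epigraph replace the values of \<open>g\<close>, so points
    with infinite value drop out and the infimum is a real one.\<close>
  define S where "S = {r + q z |z r. g z \<le> ereal r}"
  have low: "ga - 1 - L * norm (x - a) - L\<^sup>2 / (4 * k) \<le> r + q z" if "g z \<le> ereal r" for z r
  proof -
    define N where "N = norm (z - x)"
    have "norm (z - a) \<le> N + norm (x - a)"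
      using norm_triangle_ineq[of "z - x" "x - a"] by (simp add: N_def)
    then have "L * norm (z - a) \<le> L * N + L * norm (x - a)"
      using L(1) by (metis distrib_left mult_left_mono)
    \<comment> \<open>The quadratic term absorbs the linear growth: complete the square in
      \<open>N\<close>.\<close>
    moreover have "L * N \<le> L\<^sup>2 / (4 * k) + k * N\<^sup>2"
    proof -
      have "k * (N - L / (2 * k))\<^sup>2 \<ge> 0" using k by simp
      moreover have "k * (N - L / (2 * k))\<^sup>2 = k * N\<^sup>2 - L * N + L\<^sup>2 / (4 * k)"
        using k by (simp add: power2_eq_square field_simps)
      ultimately show ?thesis by simp
    qed
    ultimately show ?thesis using L(2)[OF that] by (simp add: q_def N_def)
  qed
  have bdd: "bdd_below S" unfolding S_def by (rule bdd_belowI) (use low in auto)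
  have ne: "S \<noteq> {}" using ga by (auto simp: S_def intro!: exI[of _ a] exI[of _ ga])
  define m where "m = Inf S"
  have m_le: "m \<le> r + q z" if "g z \<le> ereal r" for z r
    unfolding m_def by (rule cInf_lower[OF _ bdd]) (use that in \<open>auto simp: S_def\<close>)
  have "\<exists>z r. g z \<le> ereal r \<and> r + q z < m + 1 / Suc n" for n
  proof -
    have "\<exists>v\<in>S. v < m + 1 / Suc n"
      using cInf_less_iff[OF ne bdd, of "m + 1 / Suc n"] by (simp add: m_def)
    then show ?thesis by (auto simp: S_def)
  qed
  then obtain z r where zr: "\<And>n. g (z n) \<le> ereal (r n)" "\<And>n. r n + q (z n) < m + 1 / Suc n"
    by metis
  \<comment> \<open>The midpoint has regularized value at least \<open>m\<close>, and the two
    endpoints lie below \<open>m + 1 / Suc N\<close>. The parallelogram deficit, a quarter of the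
    left side, is therefore at most \<open>1 / Suc N\<close>.\<close>
  have gap: "k * (norm (z i - z j))\<^sup>2 \<le> 4 / Suc N" if "N \<le> i" "N \<le> j" for i j N
  proof -
    let ?c = "(1 - 1/2) *\<^sub>R z i + (1/2) *\<^sub>R z j"
    have "g ?c \<le> ereal ((1 - 1/2) * r i + 1/2 * r j)"
      by (rule convex_funD[OF cvx zr(1) zr(1)]) auto
    from m_le[OF this] have "m \<le> (r i + r j) / 2 + q ?c" by (simp add: add_divide_distrib)
    moreover have "q ?c = (q (z i) + q (z j)) / 2 - k * (norm (z i - z j))\<^sup>2 / 4"
    proof -
      have "(norm ((1/2) *\<^sub>R (a + b)))\<^sup>2 = ((norm a)\<^sup>2 + (norm b)\<^sup>2) / 2 - (norm (a - b))\<^sup>2 / 4"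
        for a b :: 'a
        unfolding power2_norm_eq_inner by (simp add: inner_simps inner_commute[of b a] field_simps)
      from this[of "z i - x" "z j - x"] have "(norm (?c - x))\<^sup>2
          = ((norm (z i - x))\<^sup>2 + (norm (z j - x))\<^sup>2) / 2 - (norm (z i - z j))\<^sup>2 / 4"
        using scaleR_half_double[of x] by (simp add: algebra_simps)
      then show ?thesis unfolding q_def
        by (simp only:) (simp add: right_diff_distrib distrib_left)
    qed
    moreover have "r i + q (z i) < m + 1 / Suc N"
      using zr(2)[of i] that frac_le[of 1 1 "Suc N" "Suc i"] by simp
    moreover have "r j + q (z j) < m + 1 / Suc N"
      using zr(2)[of j] that frac_le[of 1 1 "Suc N" "Suc j"] by simp
    ultimately have "k * (norm (z i - z j))\<^sup>2 \<le> 4 * (1 / Suc N)" by argo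
    then show ?thesis by simp
  qed
  have "Cauchy z"
  proof (rule metric_CauchyI)
    fix e :: real assume e: "e > 0"
    obtain N where N: "4 / (k * e\<^sup>2) < Suc N" using reals_Archimedean2
      by (metis less_Suc_eq of_nat_less_iff order.strict_trans)
    have "dist (z i) (z j) < e" if "i \<ge> N" "j \<ge> N" for i j
    proof -
      have "k * (norm (z i - z j))\<^sup>2 < k * e\<^sup>2"
      proof -
        have "4 / Suc N < k * e\<^sup>2" using N k e by (simp add: field_simps)
        then show ?thesis using gap[OF that] by linarith
      qed
      then have "(norm (z i - z j))\<^sup>2 < e\<^sup>2" using k by simp
      then show ?thesis using e by (simp add: dist_norm power2_less_imp_less)
    qed
    then show "\<exists>M. \<forall>i\<ge>M. \<forall>j\<ge>M. dist (z i) (z j) < e" by blast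
  qed
  then obtain p where p: "z \<longlonglongrightarrow> p" using Cauchy_convergent convergent_def by blast
  \<comment> \<open>Since \<open>r n < m + 1 / Suc n - q (z n)\<close>, lower semi-continuity passes
    to the limit of the right side, kept in the unsimplified form that the limit rules
    produce.\<close>
  have "g p \<le> ereal (m + 0 - q p)"
  proof (rule lsc_fun_sequentially[OF lsc p])
    show "(\<lambda>n. m + 1 / Suc n - q (z n)) \<longlonglongrightarrow> m + 0 - q p"
      unfolding q_def
      by (intro tendsto_diff tendsto_add tendsto_mult tendsto_power tendsto_norm tendsto_const p
          LIMSEQ_Suc[OF lim_1_over_n])
    show "g (z n) \<le> ereal (m + 1 / Suc n - q (z n))" for n
      using zr(1)[of n] zr(2)[of n] by (smt (verit) ereal_less_eq(3) order_trans)
  qed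
  moreover have "g p \<noteq> -\<infinity>" using pr by (auto simp: proper_fun_def)
  ultimately obtain b where b: "g p = ereal b" "b \<le> m - q p" by (cases "g p") auto
  then show ?thesis using that[of p b] m_le by (force simp: q_def)
qed

text \<open>This is the optimality condition that \<open>2 * k\<close> times \<open>x - p\<close> is
  a subgradient of \<open>g\<close> at \<open>p\<close>. Compare \<open>p\<close> with the point at
  parameter \<open>t\<close> on the segment to \<open>z\<close>, divide by \<open>t\<close>, and let
  \<open>t\<close> decrease to 0.\<close>

lemma regularized_minimizer_subgradient:
  fixes g :: "'a::real_inner \<Rightarrow> ereal"
  assumes cvx: "convex_fun g" and p: "g p = ereal b"
    and min: "\<And>z s. g z \<le> ereal s \<Longrightarrow> b + k * (norm (p - x))\<^sup>2 \<le> s + k * (norm (z - x))\<^sup>2"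
    and z: "g z \<le> ereal s"
  shows "b + 2 * k * ((x - p) \<bullet> (z - p)) \<le> s"
proof -
  have main: "0 \<le> (s - b - 2 * k * ((x - p) \<bullet> (z - p))) + t * (k * (norm (z - p))\<^sup>2)"
    if t: "0 < t" "t \<le> 1" for t
  proof -
    let ?c = "(1 - t) *\<^sub>R p + t *\<^sub>R z"
    have "g ?c \<le> ereal ((1 - t) * b + t * s)"
      by (rule convex_funD[OF cvx _ z]) (use t p in auto)
    from min[OF this]
    have "b + k * (norm (p - x))\<^sup>2 \<le> (1 - t) * b + t * s + k * (norm (?c - x))\<^sup>2" .
    moreover have "(norm (?c - x))\<^sup>2
      = (norm (p - x))\<^sup>2 - 2 * t * ((x - p) \<bullet> (z - p)) + t\<^sup>2 * (norm (z - p))\<^sup>2"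
    proof -
      have "?c - x = t *\<^sub>R (z - p) - (x - p)" by (simp add: algebra_simps)
      moreover have "p - x = - (x - p)" by simp
      ultimately show ?thesis unfolding power2_norm_eq_inner
        by (simp only:) (simp add: inner_simps inner_commute algebra_simps power2_eq_square)
    qed
    ultimately have "b + k * (norm (p - x))\<^sup>2 \<le> (1 - t) * b + t * s + k * ((norm (p - x))\<^sup>2
        - 2 * t * ((x - p) \<bullet> (z - p)) + t\<^sup>2 * (norm (z - p))\<^sup>2)"
      by simp
    moreover have "(1 - t) * b + t * s + k * (n - 2 * t * i + t\<^sup>2 * d) - (b + k * n)
        = t * ((s - b - 2 * k * i) + t * (k * d))" for n i d :: real
      by (simp add: algebra_simps power2_eq_square)
    ultimately have "0 \<le> t * ((s - b - 2 * k * ((x - p) \<bullet> (z - p))) + t * (k * (norm (z - p))\<^sup>2))"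
      by (metis diff_ge_0_iff_ge)
    then show ?thesis using t by (simp add: zero_le_mult_iff)
  qed
  define A where "A = s - b - 2 * k * ((x - p) \<bullet> (z - p))"
  define B where "B = k * (norm (z - p))\<^sup>2"
  have "((\<lambda>t. A + t * B) \<longlongrightarrow> A + 0 * B) (at_right 0)" by (intro tendsto_intros)
  moreover have "\<forall>\<^sub>F t in at_right 0. 0 \<le> A + t * B"
    unfolding eventually_at_right_field using main
    by (intro exI[of _ 1]) (auto simp: A_def B_def)
  ultimately have "0 \<le> A + 0 * B" by (intro tendsto_lowerbound) auto
  then show ?thesis by (simp add: A_def)
qed

text \<open>The only access to the description operator in \<open>prox\<close>. A second minimizer
  \<open>p'\<close> coincides with \<open>p\<close>: the subgradient inequality at \<open>p\<close>,
  tested at \<open>p'\<close>, and the expansion of the square around \<open>p\<close> force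
  \<open>k * (norm (p' - p))\<^sup>2\<close> to be at most 0.\<close>

lemma prox_subgradient:
  fixes g :: "'a::{real_inner, complete_space} \<Rightarrow> ereal"
  assumes pr: "proper_fun g" and cvx: "convex_fun g" and lsc: "lsc_fun g" and \<gamma>: "\<gamma> > 0"
  obtains b where "g (prox \<gamma> g x) = ereal b"
    "\<And>z s. g z \<le> ereal s \<Longrightarrow> b + (x - prox \<gamma> g x) \<bullet> (z - prox \<gamma> g x) / \<gamma> \<le> s"
proof -
  define k where "k = 1 / (2 * \<gamma>)"
  have k: "k > 0" using \<gamma> by (simp add: k_def)
  obtain p b where p: "g p = ereal b"
    and min: "\<And>z s. g z \<le> ereal s \<Longrightarrow> b + k * (norm (p - x))\<^sup>2 \<le> s + k * (norm (z - x))\<^sup>2"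
    using exists_regularized_minimizer[OF pr cvx lsc k] by blast
  have sub: "b + (x - p) \<bullet> (z - p) / \<gamma> \<le> s" if "g z \<le> ereal s" for z s
    using regularized_minimizer_subgradient[OF cvx p min that] by (simp add: k_def)
  define h where "h z = g z + ereal (k * (norm (z - x))\<^sup>2)" for z
  have "minimizer h p"
  proof (unfold is_arg_min_def, intro conjI notI TrueI)
    assume "\<exists>y. True \<and> h y < h p"
    then obtain y where y: "h y < h p" by auto
    have "g y \<noteq> -\<infinity>" using pr by (auto simp: proper_fun_def)
    with y p show False by (cases "g y") (auto simp: h_def dest: min[of y, OF eq_refl])
  qed
  moreover have "p' = p" if "minimizer h p'" for p'
  proof -
    have "h p' \<le> h p" using that by (auto simp: is_arg_min_def not_less)
    moreover have "g p' \<noteq> -\<infinity>" using pr by (auto simp: proper_fun_def)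
    ultimately obtain b' where b': "g p' = ereal b'"
      and le: "b' + k * (norm (p' - x))\<^sup>2 \<le> b + k * (norm (p - x))\<^sup>2"
      using p by (cases "g p'") (auto simp: h_def)
    have "b + 2 * k * ((x - p) \<bullet> (p' - p)) \<le> b'"
      by (rule regularized_minimizer_subgradient[OF cvx p min]) (simp_all add: b')
    moreover have "(norm (p' - x))\<^sup>2 = (norm (p - x))\<^sup>2 - 2 * ((x - p) \<bullet> (p' - p)) + (norm (p' - p))\<^sup>2"
    proof -
      have "p' - x = (p' - p) - (x - p)" "p - x = - (x - p)" by simp_all
      then show ?thesis unfolding power2_norm_eq_inner
        by (simp only:) (simp add: inner_simps inner_commute algebra_simps)
    qed
    then have "k * (norm (p' - x))\<^sup>2
      = k * (norm (p - x))\<^sup>2 - 2 * k * ((x - p) \<bullet> (p' - p)) + k * (norm (p' - p))\<^sup>2"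
      by (simp only:) (simp only: distrib_left right_diff_distrib mult.assoc mult.left_commute)
    ultimately have "k * (norm (p' - p))\<^sup>2 \<le> 0" using le by linarith
    then show ?thesis using k by (simp add: mult_le_0_iff)
  qed
  ultimately have "(THE p. minimizer h p) = p" by (rule the_equality)
  then have "prox \<gamma> g x = p" by (simp only: prox_def h_def[abs_def] k_def)
  then show ?thesis using that p sub by blast
qed

section \<open>Weak convergence in Hilbert spaces\<close>

text \<open>The projection onto \<open>C\<close> is the proximal point of its indicator function
  with step-size 1, and the subgradient inequality becomes the obtuse angle condition.\<close>

lemma closed_convex_projection:
  fixes C :: "'a::{real_inner, complete_space} set"
  assumes "closed C" "convex C" "C \<noteq> {}"
  obtains p where "p \<in> C" "\<And>z. z \<in> C \<Longrightarrow> (x - p) \<bullet> (z - p) \<le> 0"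
proof -
  define g :: "'a \<Rightarrow> ereal" where "g z = (if z \<in> C then 0 else \<infinity>)" for z
  have "proper_fun g" using assms(3) by (auto simp: proper_fun_def g_def)
  moreover have "convex_fun g"
  proof -
    have "{(z, r::real). g z \<le> ereal r} = C \<times> {0..}"
      by (auto simp: g_def zero_ereal_def split: if_splits)
    then show ?thesis using assms(2) by (simp add: convex_fun_def convex_Times)
  qed
  moreover have "lsc_fun g" unfolding lsc_fun_iff
  proof (intro allI impI)
    fix z y assume y: "y < g z"
    show "\<forall>\<^sub>F a in nhds z. y < g a"
    proof (cases "z \<in> C")
      case True
      then show ?thesis using y by (auto simp: g_def less_le_trans)
    next
      case False
      then have "\<forall>\<^sub>F a in nhds z. a \<in> - C" using assms(1) by (intro eventually_nhds_in_open) auto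
      then show ?thesis by eventually_elim (use y False in \<open>auto simp: g_def\<close>)
    qed
  qed
  ultimately obtain b where b: "g (prox 1 g x) = ereal b"
    "\<And>z s. g z \<le> ereal s \<Longrightarrow> b + (x - prox 1 g x) \<bullet> (z - prox 1 g x) / 1 \<le> s"
    using prox_subgradient[of g 1 x] by auto
  then have p: "prox 1 g x \<in> C" "b = 0" by (auto simp: g_def zero_ereal_def split: if_splits)
  moreover have "(x - prox 1 g x) \<bullet> (z - prox 1 g x) \<le> 0" if "z \<in> C" for z
    using b(2)[of z 0] that p by (simp add: g_def zero_ereal_def)
  ultimately show ?thesis using that by blast
qed

text \<open>The Riesz vector of \<open>\<phi>\<close> is the proximal point of \<open>- \<phi>\<close> at the origin.\<close>

lemma riesz_representation:
  fixes \<phi> :: "'a::{real_inner, complete_space} \<Rightarrow> real"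
  assumes "bounded_linear \<phi>"
  obtains l where "\<And>y. \<phi> y = l \<bullet> y"
proof -
  interpret bounded_linear \<phi> by fact
  define g where "g z = ereal (- \<phi> z)" for z
  have "proper_fun g" by (auto simp: proper_fun_def g_def)
  moreover have "convex_fun g"
    unfolding convex_fun_def
  proof (rule convexI)
    fix A B :: "'a \<times> real" and u v :: real
    assume *: "A \<in> {(x, r). g x \<le> ereal r}" "B \<in> {(x, r). g x \<le> ereal r}" "0 \<le> u" "0 \<le> v"
    obtain a r b s where AB: "A = (a, r)" "B = (b, s)" by (cases A, cases B)
    have "u * (- \<phi> a) + v * (- \<phi> b) \<le> u * r + v * s"
      using * by (intro add_mono mult_left_mono) (auto simp: AB g_def)
    then show "u *\<^sub>R A + v *\<^sub>R B \<in> {(x, r). g x \<le> ereal r}"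
      by (simp add: AB g_def add scaleR)
  qed
  moreover have "lsc_fun g" unfolding lsc_fun_def
  proof
    fix z
    have "(\<phi> \<longlongrightarrow> \<phi> z) (nhds z)"
      using linear_continuous_at[OF assms, of z] by (simp add: isCont_def tendsto_at_iff_tendsto_nhds)
    then have "(g \<longlongrightarrow> g z) (nhds z)" unfolding g_def by (intro tendsto_intros)
    then show "g z \<le> Liminf (nhds z) g" by (simp add: lim_imp_Liminf)
  qed
  ultimately obtain b where b: "g (prox 1 g 0) = ereal b"
    "\<And>z s. g z \<le> ereal s \<Longrightarrow> b + (0 - prox 1 g 0) \<bullet> (z - prox 1 g 0) / 1 \<le> s"
    using prox_subgradient[of g 1 0] by auto
  define l where "l = prox 1 g 0"
  \<comment> \<open>At \<open>l + v\<close> the value of the functional at \<open>l\<close> cancels,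
    which leaves a comparison of two linear functionals; applying it to \<open>v\<close> and
    \<open>- v\<close> gives equality.\<close>
  have le: "\<phi> v \<le> l \<bullet> v" for v
    using b(2)[of "l + v" "- \<phi> (l + v)"] b(1) by (simp add: g_def add flip: l_def)
  have "\<phi> y = l \<bullet> y" for y using le[of y] le[of "- y"] by (simp add: neg)
  then show ?thesis using that by blast
qed

text \<open>Let \<open>p\<close> be the projection of \<open>l\<close> onto \<open>C\<close>.
  Testing weak convergence against \<open>l - p\<close> carries the obtuse angle condition over to
  \<open>l\<close> itself, so the squared distance from \<open>l\<close> to \<open>p\<close>
  vanishes.\<close>

lemma weakly_converges_mem_closed_convex:
  fixes C :: "'a::{real_inner, complete_space} set"
  assumes C: "closed C" "convex C" and u: "weakly_converges u l"
    and ev: "\<forall>\<^sub>F n in sequentially. u n \<in> C"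
  shows "l \<in> C"
proof -
  have "C \<noteq> {}" using ev by (metis empty_iff eventually_sequentially order_refl)
  then obtain p where p: "p \<in> C" "\<And>z. z \<in> C \<Longrightarrow> (l - p) \<bullet> (z - p) \<le> 0"
    using closed_convex_projection[OF C] by blast
  have "(\<lambda>n. u n \<bullet> (l - p) - (l - p) \<bullet> p) \<longlonglongrightarrow> l \<bullet> (l - p) - (l - p) \<bullet> p"
    by (intro tendsto_diff tendsto_const u[unfolded weakly_converges_def, rule_format])
  moreover have "\<forall>\<^sub>F n in sequentially. u n \<bullet> (l - p) - (l - p) \<bullet> p \<le> 0"
    using ev by eventually_elim (use p(2) in \<open>force simp: inner_diff_right inner_commute[of "l - p"] inner_commute[of l p]\<close>)
  ultimately have "l \<bullet> (l - p) - (l - p) \<bullet> p \<le> 0" by (intro tendsto_upperbound) auto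
  then have "(l - p) \<bullet> (l - p) \<le> 0" by (simp add: inner_simps inner_commute)
  then have "l = p" by (metis eq_iff_diff_eq_0 inner_eq_zero_iff inner_ge_zero order_antisym)
  then show ?thesis using p by simp
qed

text \<open>Uniform boundedness by Baire category: the closed sets \<open>A k\<close> cover the
  space because convergent real sequences are bounded, so one of them contains a ball.\<close>

lemma weakly_converges_imp_bounded:
  fixes u :: "nat \<Rightarrow> 'a::{real_inner, complete_space}"
  assumes u: "weakly_converges u l"
  obtains M where "\<And>n. norm (u n) \<le> M"
proof -
  define A where "A k = {y. \<forall>n. \<bar>u n \<bullet> y\<bar> \<le> real k}" for k :: nat
  have cl: "closed (A k)" for k
  proof -
    have "A k = (\<Inter>n. {y. \<bar>u n \<bullet> y\<bar> \<le> real k})" by (auto simp: A_def)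
    then show ?thesis by (simp only:) (intro closed_INT ballI closed_Collect_le continuous_intros)
  qed
  have cover: "\<Union>(range A) = UNIV"
  proof -
    have "y \<in> \<Union>(range A)" for y
    proof -
      have "Bseq (\<lambda>n. u n \<bullet> y)"
        using u unfolding weakly_converges_def by (meson convergentI convergent_imp_Bseq)
      then obtain K where "\<And>n. \<bar>u n \<bullet> y\<bar> \<le> K" unfolding Bseq_def by auto
      then have "y \<in> A (nat \<lceil>K\<rceil>)"
        unfolding A_def by (auto intro: order_trans[OF _ real_nat_ceiling_ge])
      then show ?thesis by blast
    qed
    then show ?thesis by blast
  qed
  have "\<exists>k. interior (A k) \<noteq> {}"
  proof (rule ccontr)
    assume "\<not> ?thesis"
    then have "closedin euclidean T \<and> euclidean interior_of T = {}" if "T \<in> range A" for T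
      using that cl by auto
    moreover have "countable (range A)" by simp
    ultimately have "euclidean interior_of \<Union>(range A) = {}"
      using Met_TC.metric_Baire_category_alt[where ?'a = 'a, of "range A"]
      unfolding mtopology_is_euclidean mcomplete_iff_complete
      using complete_UNIV by blast
    moreover have "euclidean interior_of (UNIV :: 'a set) = UNIV" by simp
    ultimately show False unfolding cover by blast
  qed
  then obtain k c e where e: "e > 0" "ball c e \<subseteq> A k" by (metis ex_in_conv mem_interior)
  \<comment> \<open>Both \<open>c\<close> and \<open>c + v\<close> lie in \<open>A k\<close>, so the
    inner product of \<open>u n\<close> with \<open>v\<close> is at most \<open>2 * k\<close>; since
    \<open>v\<close> is \<open>u n\<close> rescaled to length \<open>e / 2\<close>, this inner
    product is \<open>e / 2 * norm (u n)\<close>.\<close>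
  have "norm (u n) \<le> 4 * real k / e" for n
  proof (cases "u n = 0")
    case False
    define v where "v = (e / 2 / norm (u n)) *\<^sub>R u n"
    have "norm v = e / 2" using False e by (simp add: v_def)
    then have "c + v \<in> A k" "c \<in> A k" using e by (auto intro!: subsetD[OF e(2)] simp: dist_norm)
    then have "\<bar>u n \<bullet> (c + v)\<bar> \<le> k" "\<bar>u n \<bullet> c\<bar> \<le> k" by (auto simp: A_def)
    then have "u n \<bullet> v \<le> 2 * k" by (simp add: inner_add_right)
    also have "u n \<bullet> v = e / 2 * norm (u n)"
      using False by (simp add: v_def power2_norm_eq_inner[symmetric] power2_eq_square)
    finally show ?thesis using e by (simp add: field_simps)
  qed (use e in simp)
  then show ?thesis using that by blast
qed

text \<open>
  The vectors whose inner products with the diagonal subsequence converge form a closed subspace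
  that contains every \<open>u m\<close> and, trivially, everything orthogonal to all of them.
\<close>

lemma bounded_imp_weak_seq_cluster_point:
  fixes u :: "nat \<Rightarrow> 'a::{real_inner, complete_space}"
  assumes "bounded (range u)"
  obtains l where "weak_seq_cluster_point u l"
proof -
  obtain M where M: "M > 0" "\<And>n. norm (u n) \<le> M"
    using assms by (auto simp: bounded_pos)
  have bd: "\<bar>u n \<bullet> y\<bar> \<le> M * norm y" for n y
    by (meson Cauchy_Schwarz_ineq2 M(2) mult_right_mono norm_ge_zero order_trans)
  \<comment> \<open>Stage \<open>m\<close> of the diagonal argument makes the inner products with
    \<open>u m\<close> converge. Testing against the sequence itself suffices, so separability of
    the space never enters.\<close>
  interpret subseqs "\<lambda>m s. convergent (\<lambda>k. u (s k) \<bullet> u m)"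
  proof
    fix m and s :: "nat \<Rightarrow> nat" assume "strict_mono s"
    have "bounded (range (\<lambda>k. u (s k) \<bullet> u m))"
      using bd by (intro boundedI[of _ "M * norm (u m)"]) auto
    then obtain l r where "strict_mono r" "((\<lambda>k. u (s k) \<bullet> u m) \<circ> r) \<longlonglongrightarrow> l"
      using bounded_imp_convergent_subsequence by blast
    then show "\<exists>r. strict_mono r \<and> convergent (\<lambda>k. u ((s \<circ> r) k) \<bullet> u m)"
      by (auto simp: convergent_def o_def)
  qed
  define r where "r = diagseq"
  have r: "strict_mono r" by (simp add: r_def subseq_diagseq)
  have conv_u: "convergent (\<lambda>k. u (r k) \<bullet> u m)" for m
  proof -
    \<comment> \<open>Only from position \<open>Suc m\<close> on is the diagonal sequence a
      subsequence of one that converges against \<open>u m\<close>; the finitely many earlier terms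
      are restored afterwards.\<close>
    have "convergent (\<lambda>k. u ((r \<circ> (+) (Suc m)) k) \<bullet> u m)"
      unfolding r_def
    proof (rule diagseq_holds)
      fix r s n assume "strict_mono (r::nat \<Rightarrow> nat)" "convergent (\<lambda>k. u (s k) \<bullet> u n)"
      then show "convergent (\<lambda>k. u ((s \<circ> r) k) \<bullet> u n)"
        using convergent_subseq_convergent[of "\<lambda>k. u (s k) \<bullet> u n" r] by (simp add: o_def)
    qed
    then have "convergent (\<lambda>k. u (r (k + Suc m)) \<bullet> u m)" by (simp add: add.commute)
    then show ?thesis by (rule convergent_ignore_initial_segment[THEN iffD1])
  qed
  define S where "S = {y. convergent (\<lambda>k. u (r k) \<bullet> y)}"
  have uS: "u m \<in> S" for m using conv_u by (simp add: S_def)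
  have sub: "subspace S"
    by (auto simp: subspace_def S_def inner_add_right convergent_const
        intro: convergent_add convergent_mult)
  have "closed S"
  proof (unfold closed_sequential_limits, intro allI impI, elim conjE)
    fix Y y assume Y: "\<forall>n. Y n \<in> S" "Y \<longlonglongrightarrow> y"
    have "Cauchy (\<lambda>k. u (r k) \<bullet> y)"
    proof (rule metric_CauchyI)
      fix e :: real assume e: "e > 0"
      \<comment> \<open>Replacing \<open>y\<close> by \<open>Y j\<close> changes every inner product
        with \<open>u (r a)\<close> by less than \<open>e / 3\<close>, uniformly in
        \<open>a\<close>, because \<open>M\<close> bounds the sequence.\<close>
      have "e / (3 * M) > 0" using e M by simp
      then obtain j where j: "norm (Y j - y) < e / (3 * M)"
        using Y(2) unfolding lim_sequentially dist_norm by blast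
      have "Cauchy (\<lambda>k. u (r k) \<bullet> Y j)" using Y(1) by (auto simp: S_def convergent_Cauchy)
      then obtain N where N: "\<And>a b. N \<le> a \<Longrightarrow> N \<le> b \<Longrightarrow> dist (u (r a) \<bullet> Y j) (u (r b) \<bullet> Y j) < e / 3"
        using e unfolding Cauchy_def by (metis divide_pos_pos zero_less_numeral)
      have close: "\<bar>u (r a) \<bullet> Y j - u (r a) \<bullet> y\<bar> < e / 3" for a
      proof -
        have "\<bar>u (r a) \<bullet> (Y j - y)\<bar> \<le> M * norm (Y j - y)" by (rule bd)
        also have "\<dots> < M * (e / (3 * M))" using j M by (intro mult_strict_left_mono) auto
        finally show ?thesis using M by (simp add: inner_diff_right)
      qed
      have "dist (u (r a) \<bullet> y) (u (r b) \<bullet> y) < e" if "N \<le> a" "N \<le> b" for a b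
        using N[OF that] close[of a] close[of b] unfolding dist_real_def abs_less_iff by linarith
      then show "\<exists>N. \<forall>a\<ge>N. \<forall>b\<ge>N. dist (u (r a) \<bullet> y) (u (r b) \<bullet> y) < e" by blast
    qed
    then show "y \<in> S" by (simp add: S_def Cauchy_convergent_iff)
  qed
  have "y \<in> S" for y
  proof -
    obtain p where p: "p \<in> S" "\<And>z. z \<in> S \<Longrightarrow> (y - p) \<bullet> (z - p) \<le> 0"
      using closed_convex_projection[OF \<open>closed S\<close> subspace_imp_convex[OF sub]]
        subspace_0[OF sub] by blast
    \<comment> \<open>Both \<open>p + v\<close> and \<open>p - v\<close> lie in the subspace, so the
      projection inequality holds with either sign and becomes orthogonality.\<close>
    have "(y - p) \<bullet> v = 0" if "v \<in> S" for v
      using p(2)[of "p + v"] p(2)[of "p - v"] that p(1) sub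
      by (simp add: subspace_add subspace_diff)
    then have "u (r k) \<bullet> (y - p) = 0" for k using uS by (metis inner_commute)
    then have "y - p \<in> S" by (simp add: S_def convergent_const)
    then show ?thesis using p(1) subspace_add[OF sub] by (metis diff_add_cancel)
  qed
  then have conv: "(\<lambda>k. u (r k) \<bullet> y) \<longlonglongrightarrow> lim (\<lambda>k. u (r k) \<bullet> y)" for y
    by (auto simp: S_def convergent_LIMSEQ_iff)
  define \<phi> where "\<phi> y = lim (\<lambda>k. u (r k) \<bullet> y)" for y
  have "bounded_linear \<phi>"
  proof
    show "\<phi> (a + b) = \<phi> a + \<phi> b" for a b
      unfolding \<phi>_def by (rule limI) (auto simp: inner_add_right intro!: tendsto_add conv)
    show "\<phi> (c *\<^sub>R a) = c *\<^sub>R \<phi> a" for a c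
      unfolding \<phi>_def by (rule limI) (auto intro!: tendsto_mult conv)
    have "norm (\<phi> y) \<le> norm y * M" for y
      unfolding \<phi>_def by (rule LIMSEQ_le_const2[OF tendsto_norm[OF conv]])
        (use bd in \<open>auto simp: mult.commute\<close>)
    then show "\<exists>K. \<forall>y. norm (\<phi> y) \<le> norm y * K" by blast
  qed
  then obtain l where "\<And>y. \<phi> y = l \<bullet> y" using riesz_representation by blast
  then have "weakly_converges (u \<circ> r) l"
    using conv by (simp add: weakly_converges_def \<phi>_def)
  then show ?thesis using that r by (auto simp: weak_seq_cluster_point_def)
qed

text \<open>If the norms do not diverge, infinitely many terms lie in one ball; the bounded
  subsequence they form has a weak cluster point, which is also one of \<open>u\<close>.\<close>

lemma norm_at_top_if_no_weak_cluster_point: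
  fixes u :: "nat \<Rightarrow> 'a::{real_inner, complete_space}"
  assumes "\<nexists>z. weak_seq_cluster_point u z"
  shows "filterlim (\<lambda>n. norm (u n)) at_top sequentially"
proof (rule ccontr)
  assume "\<not> ?thesis"
  then obtain Z where "\<exists>\<^sub>F n in sequentially. norm (u n) \<le> Z"
    by (auto simp: filterlim_at_top_dense not_eventually not_less)
  then have "infinite {n. norm (u n) \<le> Z}"
    by (simp add: frequently_cofinite flip: cofinite_eq_sequentially)
  then obtain r :: "nat \<Rightarrow> nat" where r: "strict_mono r" "\<And>n. r n \<in> {n. norm (u n) \<le> Z}"
    using infinite_enumerate by blast
  then have "bounded (range (u \<circ> r))" by (auto intro!: boundedI)
  then obtain z where "weak_seq_cluster_point (u \<circ> r) z" using bounded_imp_weak_seq_cluster_point by blast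
  then obtain q where "strict_mono q" "weakly_converges (u \<circ> (r \<circ> q)) z"
    unfolding weak_seq_cluster_point_def by (auto simp: o_assoc)
  then have "weak_seq_cluster_point u z"
    unfolding weak_seq_cluster_point_def using strict_mono_o[OF r(1)] by blast
  then show False using assms by blast
qed

section \<open>Convex functions with Lipschitz gradient\<close>

lemma GDERIV_along_line:
  assumes "\<forall>z. GDERIV f z :> gradf z"
  shows "((\<lambda>t. f (x + t *\<^sub>R v)) has_real_derivative gradf (x + t *\<^sub>R v) \<bullet> v) (at t)"
proof -
  have "(f has_derivative (\<lambda>h. h \<bullet> gradf (x + t *\<^sub>R v))) (at (x + t *\<^sub>R v))"
    using assms by (simp add: gderiv_def)
  moreover have "((\<lambda>t. x + t *\<^sub>R v) has_derivative (\<lambda>h. h *\<^sub>R v)) (at t)"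
    by (auto intro!: derivative_eq_intros)
  ultimately have "((\<lambda>t. f (x + t *\<^sub>R v)) has_derivative (\<lambda>h. (h *\<^sub>R v) \<bullet> gradf (x + t *\<^sub>R v))) (at t)"
    by (rule has_derivative_compose[rotated])
  then show ?thesis
    by (simp add: has_field_derivative_def inner_commute mult_commute_abs)
qed

text \<open>Restricting to the line through \<open>x\<close> and \<open>y\<close> reduces this to
  the tangent inequality of a convex real function at 0, evaluated at 1.\<close>

lemma convex_gradient_inequality:
  assumes "convex_on UNIV f" "\<forall>z. GDERIV f z :> gradf z"
  shows "f x + gradf x \<bullet> (y - x) \<le> f y"
proof -
  define \<phi> where "\<phi> t = f (x + t *\<^sub>R (y - x))" for t
  have "convex_on UNIV \<phi>"
  proof (rule convex_onI)
    fix t a b :: real assume t: "0 < t" "t < 1"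
    have "x + ((1 - t) *\<^sub>R a + t *\<^sub>R b) *\<^sub>R (y - x)
        = (1 - t) *\<^sub>R (x + a *\<^sub>R (y - x)) + t *\<^sub>R (x + b *\<^sub>R (y - x))"
      by (simp add: algebra_simps)
    then show "\<phi> ((1 - t) *\<^sub>R a + t *\<^sub>R b) \<le> (1 - t) * \<phi> a + t * \<phi> b"
      unfolding \<phi>_def by (simp only:) (use t in \<open>intro convex_onD[OF assms(1)]; simp\<close>)
  qed simp
  moreover have "(\<phi> has_real_derivative gradf x \<bullet> (y - x)) (at 0)"
    using GDERIV_along_line[OF assms(2), of x "y - x" 0] by (simp add: \<phi>_def[abs_def])
  ultimately have "gradf x \<bullet> (y - x) * (1 - 0) \<le> \<phi> 1 - \<phi> 0"
    by (intro convex_on_imp_above_tangent[where A = UNIV]) auto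
  then show ?thesis by (simp add: \<phi>_def)
qed

text \<open>Along the segment, \<open>\<psi>\<close> is \<open>f\<close> minus its quadratic model,
  up to a constant. Cauchy-Schwarz and the Lipschitz bound make its derivative nonpositive.\<close>

lemma descent_lemma:
  fixes f :: "'a::real_inner \<Rightarrow> real"
  assumes grad: "\<forall>z. GDERIV f z :> gradf z" and lip: "L-lipschitz_on UNIV gradf"
  shows "f y \<le> f x + gradf x \<bullet> (y - x) + L / 2 * (norm (y - x))\<^sup>2"
proof -
  define v where "v = y - x"
  define \<psi> where "\<psi> t = f (x + t *\<^sub>R v) - t * (gradf x \<bullet> v) - L / 2 * t\<^sup>2 * (norm v)\<^sup>2" for t
  have "\<psi> 1 \<le> \<psi> 0"
  proof (rule DERIV_nonpos_imp_nonincreasing[where f = \<psi>])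
    fix t :: real assume t: "0 \<le> t" "t \<le> 1"
    let ?D = "gradf (x + t *\<^sub>R v) \<bullet> v - gradf x \<bullet> v - L * t * (norm v)\<^sup>2"
    have "(\<psi> has_real_derivative ?D) (at t)"
      unfolding \<psi>_def by (auto intro!: derivative_eq_intros GDERIV_along_line[OF grad])
    moreover have "?D \<le> 0"
    proof -
      have "(gradf (x + t *\<^sub>R v) - gradf x) \<bullet> v \<le> norm (gradf (x + t *\<^sub>R v) - gradf x) * norm v"
        by (rule norm_cauchy_schwarz)
      also have "\<dots> \<le> (L * (t * norm v)) * norm v"
        using lipschitz_onD[OF lip, of "x + t *\<^sub>R v" x] t
        by (intro mult_right_mono) (auto simp: dist_norm)
      finally show ?thesis by (simp add: inner_diff_left power2_eq_square mult.assoc)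
    qed
    ultimately show "\<exists>D. (\<psi> has_real_derivative D) (at t) \<and> D \<le> 0" by blast
  qed simp
  then show ?thesis by (simp add: \<psi>_def v_def)
qed

text \<open>
  Bound \<open>f\<close> from above and below at the gradient step \<open>y - \<beta> (\<nabla>f y - \<nabla>f x)\<close>.
\<close>

lemma convex_lipschitz_gradient_lower_bound:
  fixes f :: "'a::real_inner \<Rightarrow> real"
  assumes cvx: "convex_on UNIV f" and grad: "\<forall>z. GDERIV f z :> gradf z"
    and lip: "(inverse \<beta>)-lipschitz_on UNIV gradf" and \<beta>: "\<beta> > 0"
  shows "f x + gradf x \<bullet> (y - x) + \<beta> / 2 * (norm (gradf y - gradf x))\<^sup>2 \<le> f y"
proof -
  define d where "d = gradf y - gradf x"
  define z where "z = y - \<beta> *\<^sub>R d"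
  have "f x + gradf x \<bullet> (z - x) \<le> f z" by (rule convex_gradient_inequality[OF cvx grad])
  also have "f z \<le> f y + gradf y \<bullet> (z - y) + inverse \<beta> / 2 * (norm (z - y))\<^sup>2"
    by (rule descent_lemma[OF grad lip])
  also have "inverse \<beta> / 2 * (norm (z - y))\<^sup>2 = \<beta> / 2 * (norm d)\<^sup>2"
    using \<beta> by (simp add: z_def power2_eq_square field_simps)
  also have "gradf y \<bullet> (z - y) = - \<beta> * (gradf y \<bullet> d)" by (simp add: z_def)
  also have "gradf x \<bullet> (z - x) = gradf x \<bullet> (y - x) - \<beta> * (gradf x \<bullet> d)"
    by (simp add: z_def inner_simps)
  finally have "f x + gradf x \<bullet> (y - x) + (\<beta> * (gradf y \<bullet> d) - \<beta> * (gradf x \<bullet> d)) - \<beta> / 2 * (norm d)\<^sup>2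
      \<le> f y" by simp
  moreover have "\<beta> * (gradf y \<bullet> d) - \<beta> * (gradf x \<bullet> d) = \<beta> * (norm d)\<^sup>2"
    by (simp add: d_def power2_norm_eq_inner inner_diff_left flip: right_diff_distrib)
  ultimately show ?thesis by (simp add: d_def)
qed

text \<open>These are the sublevel sets of the objective at height \<open>c\<close>. Moving the
  finite \<open>f\<close> to the right side avoids extended-real sums and lets
  \<open>lsc_fun_sequentially\<close> apply with varying bounds.\<close>

lemma closed_convex_sublevel:
  fixes f :: "'a::real_inner \<Rightarrow> real"
  assumes "convex_on UNIV f" "continuous_on UNIV f" "convex_fun g" "lsc_fun g"
  shows "closed {v. g v \<le> ereal (c - f v)}" "convex {v. g v \<le> ereal (c - f v)}"
proof -
  show "closed {v. g v \<le> ereal (c - f v)}"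
  proof (unfold closed_sequential_limits, intro allI impI, elim conjE)
    fix z p assume z: "\<forall>n. z n \<in> {v. g v \<le> ereal (c - f v)}" "z \<longlonglongrightarrow> p"
    have "(\<lambda>n. c - f (z n)) \<longlonglongrightarrow> c - f p"
      using assms(2) z(2) by (intro tendsto_intros continuous_on_tendsto_compose[of UNIV f]) auto
    then have "g p \<le> ereal (c - f p)"
      by (rule lsc_fun_sequentially[OF assms(4) z(2)]) (use z(1) in auto)
    then show "p \<in> {v. g v \<le> ereal (c - f v)}" by simp
  qed
  show "convex {v. g v \<le> ereal (c - f v)}"
    unfolding convex_alt
  proof (clarify)
    fix a b and t :: real
    assume ab: "g a \<le> ereal (c - f a)" "g b \<le> ereal (c - f b)" and t: "0 \<le> t" "t \<le> 1"
    let ?p = "(1 - t) *\<^sub>R a + t *\<^sub>R b"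
    have "g ?p \<le> ereal ((1 - t) * (c - f a) + t * (c - f b))"
      by (rule convex_funD[OF assms(3) ab t])
    also have "\<dots> \<le> ereal (c - f ?p)"
      using convex_onD[OF assms(1) t, of a b] by (simp add: algebra_simps)
    finally show "g ?p \<le> ereal (c - f ?p)" .
  qed
qed

text \<open>The inequality is assumed only eventually, as are the parameter bounds it comes from.
  Beyond the threshold \<open>N\<close>, partial sums telescope to at most
  \<open>L N - m\<close>.\<close>

lemma summable_if_le_telescoping:
  fixes a L :: "nat \<Rightarrow> real"
  assumes ev: "\<forall>\<^sub>F n in sequentially. a n \<le> L n - L (Suc n)"
    and nonneg: "\<And>n. 0 \<le> a n" and low: "\<And>n. m \<le> L n"
  shows "summable a"
proof -
  obtain N where N: "\<And>n. n \<ge> N \<Longrightarrow> a n \<le> L n - L (Suc n)"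
    using ev by (auto simp: eventually_sequentially)
  have "summable (\<lambda>n. a (n + N))"
  proof (rule bounded_imp_summable)
    fix n
    have "(\<Sum>k\<le>n. a (k + N)) \<le> (\<Sum>k\<le>n. L (k + N) - L (Suc k + N))"
      by (intro sum_mono) (use N in auto)
    also have "\<dots> = L N - L (Suc n + N)"
      by (subst sum_telescope) simp
    also have "\<dots> \<le> L N - m" using low by (simp add: add.commute)
    finally show "(\<Sum>k\<le>n. a (k + N)) \<le> L N - m" .
  qed (rule nonneg)
  then show ?thesis by (rule summable_iff_shift[THEN iffD1])
qed

section \<open>The forward-backward iteration with deviations\<close>

text \<open>
  Here \<open>w' = w\<^sub>n\<^sub>-\<^sub>1\<close>, \<open>w = w\<^sub>n\<close>, \<open>x = x\<^sub>n\<close>, \<open>p = x\<^sub>n\<^sub>+\<^sub>1\<close>; \<open>G'\<close>, \<open>G\<close> are the gradients and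
  \<open>\<phi>'\<close>, \<open>\<phi>\<close> the values of \<open>f\<close> at \<open>w'\<close>, \<open>w\<close>, and \<open>a\<close>, \<open>b\<close> are the values of \<open>g\<close> at \<open>x\<close>, \<open>p\<close>.
\<close>

lemma lyapunov_step:
  fixes x w w' p G G' D1 D2 :: "'a::real_inner"
  assumes \<gamma>: "0 < \<gamma>" "\<gamma> < 2 * \<beta>" and w: "w = x + D1"
    and coc: "\<phi> + G \<bullet> (w' - w) + \<beta> / 2 * (norm (G' - G))\<^sup>2 \<le> \<phi>'"
    and sub: "b + (x - \<gamma> *\<^sub>R G + (\<gamma> / \<beta>) *\<^sub>R D1 + D2 - p) \<bullet> (x - p) / \<gamma> \<le> a"
  shows "\<phi> + b + G \<bullet> (p - w) + 1 / (2 * \<beta>) * (norm (p - w))\<^sup>2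
      + (2 * \<beta> - \<gamma>) / (2 * \<beta> * \<gamma>) * (norm (p - x - (\<beta> / (2 * \<beta> - \<gamma>)) *\<^sub>R D2))\<^sup>2
      + \<beta> / 2 * (norm (G - G' - (1 / \<beta>) *\<^sub>R (x - w')))\<^sup>2
    \<le> \<phi>' + a + G' \<bullet> (x - w') + 1 / (2 * \<beta>) * (norm (x - w'))\<^sup>2
      + (1 / (2 * \<beta>) * (norm D1)\<^sup>2 + \<beta> / (2 * \<gamma> * (2 * \<beta> - \<gamma>)) * (norm D2)\<^sup>2)"
proof -
  have \<beta>: "\<beta> > 0" using \<gamma> by simp
  \<comment> \<open>One expansion serves all the squares: \<open>E1\<close>, \<open>E2\<close>, and
    \<open>E4\<close> with factor 1.\<close>
  have sq: "(norm (u - k *\<^sub>R v))\<^sup>2 = (norm u)\<^sup>2 - 2 * k * (u \<bullet> v) + k\<^sup>2 * (norm v)\<^sup>2" for u v :: 'a and k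
    unfolding power2_norm_eq_inner by (simp add: inner_simps inner_commute[of v u] power2_eq_square algebra_simps)
  define e d s where "e = x - w'" and "d = G - G'" and "s = p - x"
  have E1: "\<beta> / 2 * (norm (d - (1 / \<beta>) *\<^sub>R e))\<^sup>2
      = \<beta> / 2 * (norm d)\<^sup>2 - d \<bullet> e + 1 / (2 * \<beta>) * (norm e)\<^sup>2"
    unfolding sq using \<beta> by (simp add: field_simps power2_eq_square)
  have coef: "(2 * \<beta> - \<gamma>) / (2 * \<beta> * \<gamma>) = 1 / \<gamma> - 1 / (2 * \<beta>)"
    using \<beta> \<gamma> by (simp add: field_simps)
  \<comment> \<open>The shift by \<open>\<beta> / (2 * \<beta> - \<gamma>)\<close> is what completes
    the square in \<open>s\<close>; the remainder is exactly the \<open>D2\<close> term of the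
    deviation.\<close>
  have E2: "(2 * \<beta> - \<gamma>) / (2 * \<beta> * \<gamma>) * (norm (s - (\<beta> / (2 * \<beta> - \<gamma>)) *\<^sub>R D2))\<^sup>2
      = (1 / \<gamma> - 1 / (2 * \<beta>)) * (norm s)\<^sup>2 - s \<bullet> D2 / \<gamma>
        + \<beta> / (2 * \<gamma> * (2 * \<beta> - \<gamma>)) * (norm D2)\<^sup>2"
  proof -
    define c where "c = 2 * \<beta> - \<gamma>"
    have "c > 0" using \<gamma> by (simp add: c_def)
    have "c / (2 * \<beta> * \<gamma>) * (S - 2 * (\<beta> / c) * i + (\<beta> / c)\<^sup>2 * D)
        = c / (2 * \<beta> * \<gamma>) * S - i / \<gamma> + \<beta> / (2 * \<gamma> * c) * D" for S i D
      using \<beta> \<gamma> \<open>c > 0\<close> by (simp add: field_simps power2_eq_square)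
    then show ?thesis unfolding sq coef[symmetric] by (simp add: c_def)
  qed
  have E3: "(x - \<gamma> *\<^sub>R G + (\<gamma> / \<beta>) *\<^sub>R D1 + D2 - p) \<bullet> (x - p) / \<gamma>
      = (norm s)\<^sup>2 / \<gamma> + G \<bullet> s - s \<bullet> D1 / \<beta> - s \<bullet> D2 / \<gamma>"
  proof -
    have "x - \<gamma> *\<^sub>R G + (\<gamma> / \<beta>) *\<^sub>R D1 + D2 - p = (\<gamma> / \<beta>) *\<^sub>R D1 + D2 - s - \<gamma> *\<^sub>R G" "x - p = - s"
      by (simp_all add: s_def)
    then have "(x - \<gamma> *\<^sub>R G + (\<gamma> / \<beta>) *\<^sub>R D1 + D2 - p) \<bullet> (x - p)
        = (norm s)\<^sup>2 + \<gamma> * (G \<bullet> s) - \<gamma> / \<beta> * (s \<bullet> D1) - s \<bullet> D2"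
      unfolding power2_norm_eq_inner
      by (simp only:)
        (simp add: inner_diff_left inner_add_left inner_commute[of D1 s] inner_commute[of D2 s])
    then show ?thesis using \<beta> \<gamma> by (simp only:) (simp add: field_simps)
  qed
  have E4: "1 / (2 * \<beta>) * (norm (p - w))\<^sup>2
      = 1 / (2 * \<beta>) * (norm s)\<^sup>2 - s \<bullet> D1 / \<beta> + 1 / (2 * \<beta>) * (norm D1)\<^sup>2"
  proof -
    have "p - w = s - 1 *\<^sub>R D1" by (simp add: s_def w)
    then show ?thesis using \<beta> by (simp only: sq) (simp add: field_simps)
  qed
  have E5: "G \<bullet> (w' - w) = - (G \<bullet> e) - G \<bullet> D1" "G \<bullet> (p - w) = G \<bullet> s - G \<bullet> D1"
    by (simp_all add: e_def s_def w inner_simps)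
  have E6: "d \<bullet> e = G \<bullet> e - G' \<bullet> e" by (simp add: d_def inner_simps)
  have E7: "norm (G' - G) = norm d" by (simp add: d_def norm_minus_commute)
  have E8: "(1 / \<gamma> - 1 / (2 * \<beta>)) * (norm s)\<^sup>2 = (norm s)\<^sup>2 / \<gamma> - 1 / (2 * \<beta>) * (norm s)\<^sup>2"
    by (simp add: left_diff_distrib)
  \<comment> \<open>In terms of the elementary inner products and squared norms, the claim is
    exactly the sum of \<open>coc\<close> and \<open>sub\<close>.\<close>
  show ?thesis
    using coc sub unfolding e_def[symmetric] d_def[symmetric] s_def[symmetric] E1 E2 E3 E4 E5 E6 E7 E8
    by linarith
qed

locale forward_backward_deviations =
  fixes f :: "'a::{real_inner, complete_space} \<Rightarrow> real"
    and gradf :: "'a \<Rightarrow> 'a"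
    and g :: "'a \<Rightarrow> ereal"
    and \<beta> :: real
    and \<gamma> \<alpha>1 \<alpha>2 :: "nat \<Rightarrow> real"
    and x w \<Delta>1 \<Delta>2 :: "nat \<Rightarrow> 'a"
  assumes f_convex: "convex_on UNIV f"
    and f_grad: "\<forall>z. GDERIV f z :> gradf z"
    and \<beta>_pos: "\<beta> > 0"
    and gradf_lipschitz: "(inverse \<beta>)-lipschitz_on UNIV gradf"
    and g_proper: "proper_fun g"
    and g_convex: "convex_fun g"
    and g_lsc: "lsc_fun g"
    and \<gamma>_range: "\<forall>n. 0 < \<gamma> n \<and> \<gamma> n < 2 * \<beta>"
    and w_def: "\<forall>n. w n = x n + \<Delta>1 n"
    and x_step: "\<forall>n. x (Suc n) =
      prox (\<gamma> n) g (x n - \<gamma> n *\<^sub>R gradf (w n) + (\<gamma> n / \<beta>) *\<^sub>R \<Delta>1 n + \<Delta>2 n)"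
    and deviation_bound: "\<forall>n\<ge>1.
      1 / (2 * \<beta>) * (norm (\<Delta>1 n))\<^sup>2
        + \<beta> / (2 * \<gamma> n * (2 * \<beta> - \<gamma> n)) * (norm (\<Delta>2 n))\<^sup>2
      \<le> \<alpha>1 n * (2 * \<beta> - \<gamma> (n - 1)) / (2 * \<beta> * \<gamma> (n - 1))
          * (norm (x n - x (n - 1) - (\<beta> / (2 * \<beta> - \<gamma> (n - 1))) *\<^sub>R \<Delta>2 (n - 1)))\<^sup>2
        + \<beta> * \<alpha>2 n / 2
          * (norm (gradf (w n) - gradf (w (n - 1)) - (1 / \<beta>) *\<^sub>R (x n - w (n - 1))))\<^sup>2"
begin

text \<open>The index is shifted because \<open>x 0\<close> may lie outside the domain of
  \<open>g\<close>. \<open>real_of_ereal\<close> sends infinite values to 0, a case excluded by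
  \<open>g_iterate\<close>.\<close>

definition gval :: "nat \<Rightarrow> real" where "gval n = real_of_ereal (g (x (Suc n)))"

definition prox_arg :: "nat \<Rightarrow> 'a" where
  "prox_arg n = x n - \<gamma> n *\<^sub>R gradf (w n) + (\<gamma> n / \<beta>) *\<^sub>R \<Delta>1 n + \<Delta>2 n"

definition lyap :: "nat \<Rightarrow> real" where
  "lyap n = f (w n) + gval n + gradf (w n) \<bullet> (x (Suc n) - w n)
    + 1 / (2 * \<beta>) * (norm (x (Suc n) - w n))\<^sup>2"

text \<open>In the notation of the opening outline, \<open>lyap n\<close>,
  \<open>prox_gap n\<close>, \<open>grad_gap n\<close> and \<open>deviation n\<close> are V_n, R_n,
  Q_n and d_n.\<close>

definition prox_gap :: "nat \<Rightarrow> real" where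
  "prox_gap n = (2 * \<beta> - \<gamma> n) / (2 * \<beta> * \<gamma> n)
    * (norm (x (Suc n) - x n - (\<beta> / (2 * \<beta> - \<gamma> n)) *\<^sub>R \<Delta>2 n))\<^sup>2"

definition grad_gap :: "nat \<Rightarrow> real" where
  "grad_gap n = \<beta> / 2
    * (norm (gradf (w (Suc n)) - gradf (w n) - (1 / \<beta>) *\<^sub>R (x (Suc n) - w n)))\<^sup>2"

definition deviation :: "nat \<Rightarrow> real" where
  "deviation n = 1 / (2 * \<beta>) * (norm (\<Delta>1 n))\<^sup>2
    + \<beta> / (2 * \<gamma> n * (2 * \<beta> - \<gamma> n)) * (norm (\<Delta>2 n))\<^sup>2"

lemma \<gamma>_pos: "0 < \<gamma> n" and \<gamma>_less: "\<gamma> n < 2 * \<beta>"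
  using \<gamma>_range by auto

lemma gaps_nonneg: "0 \<le> prox_gap n" "0 \<le> grad_gap n"
  using \<beta>_pos \<gamma>_pos[of n] \<gamma>_less[of n] by (simp_all add: prox_gap_def grad_gap_def)

lemma g_iterate: "g (x (Suc n)) = ereal (gval n)"
  and g_subgradient: "g z \<le> ereal s \<Longrightarrow>
    gval n + (prox_arg n - x (Suc n)) \<bullet> (z - x (Suc n)) / \<gamma> n \<le> s"
proof -
  have x: "x (Suc n) = prox (\<gamma> n) g (prox_arg n)" using x_step by (simp add: prox_arg_def)
  obtain b where "g (x (Suc n)) = ereal b"
    "\<And>z s. g z \<le> ereal s \<Longrightarrow> b + (prox_arg n - x (Suc n)) \<bullet> (z - x (Suc n)) / \<gamma> n \<le> s"
    unfolding x using prox_subgradient[OF g_proper g_convex g_lsc \<gamma>_pos] by metis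
  moreover from this have "gval n = b" by (simp add: gval_def)
  ultimately show "g (x (Suc n)) = ereal (gval n)" "g z \<le> ereal s \<Longrightarrow>
    gval n + (prox_arg n - x (Suc n)) \<bullet> (z - x (Suc n)) / \<gamma> n \<le> s" by auto
qed

lemma lyapunov_eq: "lyapunov \<beta> f gradf g x w n = ereal (lyap n)"
  by (simp add: lyapunov_def lyap_def g_iterate)

text \<open>\<open>lyap n\<close> is the objective at \<open>x (Suc n)\<close> with \<open>f\<close>
  replaced by its quadratic upper model around \<open>w n\<close>.\<close>

lemma objective_le_lyap: "f (x (Suc n)) + gval n \<le> lyap n"
  using descent_lemma[OF f_grad gradf_lipschitz, of "x (Suc n)" "w n"] \<beta>_pos
  by (simp add: lyap_def field_simps)

lemma deviation_le:
  "deviation (Suc n) \<le> \<alpha>1 (Suc n) * prox_gap n + \<alpha>2 (Suc n) * grad_gap n"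
proof -
  have "\<alpha>1 (Suc n) * prox_gap n + \<alpha>2 (Suc n) * grad_gap n
    = \<alpha>1 (Suc n) * (2 * \<beta> - \<gamma> n) / (2 * \<beta> * \<gamma> n)
          * (norm (x (Suc n) - x n - (\<beta> / (2 * \<beta> - \<gamma> n)) *\<^sub>R \<Delta>2 n))\<^sup>2
        + \<beta> * \<alpha>2 (Suc n) / 2
          * (norm (gradf (w (Suc n)) - gradf (w n) - (1 / \<beta>) *\<^sub>R (x (Suc n) - w n)))\<^sup>2"
    by (simp add: prox_gap_def grad_gap_def mult.assoc mult.left_commute[of "\<alpha>2 _"])
  then show ?thesis using deviation_bound[rule_format, of "Suc n"] unfolding deviation_def by simp
qed

text \<open>The subgradient inequality of iteration \<open>Suc n\<close> is tested at
  \<open>x (Suc n)\<close>, where \<open>g\<close> is finite because this is already a proximal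
  point. The deviation bound then trades the deviation for the two gaps.\<close>

lemma lyap_step:
  "lyap (Suc n) + prox_gap (Suc n)
    \<le> lyap n + \<alpha>1 (Suc n) * prox_gap n - (1 - \<alpha>2 (Suc n)) * grad_gap n"
proof -
  have "lyap (Suc n) + prox_gap (Suc n) + grad_gap n \<le> lyap n + deviation (Suc n)"
    unfolding lyap_def prox_gap_def grad_gap_def deviation_def
  proof (rule lyapunov_step)
    show "f (w (Suc n)) + gradf (w (Suc n)) \<bullet> (w n - w (Suc n))
        + \<beta> / 2 * (norm (gradf (w n) - gradf (w (Suc n))))\<^sup>2 \<le> f (w n)"
      by (rule convex_lipschitz_gradient_lower_bound[OF f_convex f_grad gradf_lipschitz \<beta>_pos])
    show "gval (Suc n) + (x (Suc n) - \<gamma> (Suc n) *\<^sub>R gradf (w (Suc n))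
        + (\<gamma> (Suc n) / \<beta>) *\<^sub>R \<Delta>1 (Suc n) + \<Delta>2 (Suc n) - x (Suc (Suc n)))
        \<bullet> (x (Suc n) - x (Suc (Suc n))) / \<gamma> (Suc n) \<le> gval n"
      using g_subgradient[of "x (Suc n)" "gval n" "Suc n"] by (simp add: g_iterate prox_arg_def)
  qed (simp_all add: w_def \<gamma>_pos \<gamma>_less)
  then show ?thesis using deviation_le[of n] by (simp add: algebra_simps)
qed

lemma lyap_decreasing:
  assumes "\<alpha>1 (Suc n) \<le> 1" "\<alpha>2 (Suc n) \<le> 1"
  shows "lyap (Suc n) + prox_gap (Suc n) \<le> lyap n + prox_gap n"
proof -
  have "\<alpha>1 (Suc n) * prox_gap n \<le> 1 * prox_gap n" "0 \<le> (1 - \<alpha>2 (Suc n)) * grad_gap n"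
    using assms gaps_nonneg[of n] by (intro mult_right_mono mult_nonneg_nonneg; simp)+
  then show ?thesis using lyap_step[of n] by simp
qed

section \<open>Summability under eventual bounds on the parameters\<close>

context
  fixes m a \<delta> :: real
  assumes bounded_below: "\<And>z. ereal m \<le> ereal (f z) + g z"
    and a: "a < 1" and \<delta>: "\<delta> > 0"
    and ev_\<alpha>: "\<forall>\<^sub>F n in sequentially. \<alpha>1 n \<le> a \<and> \<alpha>2 n \<le> a"
    and ev_\<gamma>: "\<forall>\<^sub>F n in sequentially. \<gamma> n \<le> 2 * \<beta> - \<delta>"
begin

lemma summable_gaps: "summable (\<lambda>n. prox_gap n + grad_gap n)"
proof -
  have "summable (\<lambda>n. (1 - a) * (prox_gap n + grad_gap n))"
  proof (rule summable_if_le_telescoping)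
    have "\<forall>\<^sub>F n in sequentially. \<alpha>1 (Suc n) \<le> a \<and> \<alpha>2 (Suc n) \<le> a"
      using ev_\<alpha>
      by (rule eventually_sequentially_Suc[where P = "\<lambda>n. \<alpha>1 n \<le> a \<and> \<alpha>2 n \<le> a", THEN iffD2])
    then show "\<forall>\<^sub>F n in sequentially. (1 - a) * (prox_gap n + grad_gap n)
      \<le> (lyap n + prox_gap n) - (lyap (Suc n) + prox_gap (Suc n))"
    proof eventually_elim
      case (elim n)
      have "\<alpha>1 (Suc n) * prox_gap n \<le> a * prox_gap n" "\<alpha>2 (Suc n) * grad_gap n \<le> a * grad_gap n"
        using elim gaps_nonneg by (auto intro: mult_right_mono)
      then show ?case using lyap_step[of n] by (simp add: algebra_simps)
    qed
    show "0 \<le> (1 - a) * (prox_gap n + grad_gap n)" for n using a gaps_nonneg by simp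
    show "m \<le> lyap n + prox_gap n" for n
      using bounded_below[of "x (Suc n)"] objective_le_lyap[of n] gaps_nonneg(1)[of n]
      by (simp add: g_iterate)
  qed
  then show ?thesis using a by (simp add: summable_cmult_iff)
qed

lemma summable_deviations:
  "summable (\<lambda>n. (norm (\<Delta>1 n))\<^sup>2)" "summable (\<lambda>n. (norm (\<Delta>2 n))\<^sup>2)"
proof -
  have "\<forall>\<^sub>F n in sequentially. norm (deviation (Suc n)) \<le> prox_gap n + grad_gap n"
  proof -
    have "\<forall>\<^sub>F n in sequentially. \<alpha>1 (Suc n) \<le> a \<and> \<alpha>2 (Suc n) \<le> a"
      using ev_\<alpha>
      by (rule eventually_sequentially_Suc[where P = "\<lambda>n. \<alpha>1 n \<le> a \<and> \<alpha>2 n \<le> a", THEN iffD2])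
    then show ?thesis
    proof eventually_elim
      case (elim n)
      have "\<alpha>1 (Suc n) * prox_gap n \<le> 1 * prox_gap n" "\<alpha>2 (Suc n) * grad_gap n \<le> 1 * grad_gap n"
        using elim a gaps_nonneg[of n] by (intro mult_right_mono; simp)+
      moreover have "0 \<le> deviation (Suc n)"
        using \<beta>_pos \<gamma>_pos[of "Suc n"] \<gamma>_less[of "Suc n"] by (simp add: deviation_def)
      ultimately show ?case using deviation_le[of n] by simp
    qed
  qed
  then have "summable (\<lambda>n. deviation (Suc n))"
    using summable_gaps by (rule summable_comparison_test_ev)
  then have "summable deviation" by (simp add: summable_Suc_iff)
  then have dev: "summable (\<lambda>n. 2 * \<beta> * deviation n)" by (rule summable_mult)
  \<comment> \<open>Since \<open>\<gamma> n * (2 * \<beta> - \<gamma> n)\<close> is at most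
    \<open>\<beta>\<^sup>2\<close>, the factor \<open>2 * \<beta>\<close> makes both coefficients in
    the deviation at least 1, with no lower bound on the step-sizes.\<close>
  have "(norm (\<Delta>1 n))\<^sup>2 \<le> 2 * \<beta> * deviation n" "(norm (\<Delta>2 n))\<^sup>2 \<le> 2 * \<beta> * deviation n" for n
  proof -
    have "0 < \<gamma> n * (2 * \<beta> - \<gamma> n)" using \<gamma>_pos[of n] \<gamma>_less[of n] by simp
    moreover have "\<gamma> n * (2 * \<beta> - \<gamma> n) \<le> \<beta>\<^sup>2"
      using zero_le_power2[of "\<beta> - \<gamma> n"] by (simp add: power2_eq_square algebra_simps)
    ultimately have "1 \<le> \<beta>\<^sup>2 / (\<gamma> n * (2 * \<beta> - \<gamma> n))" by simp
    then have "1 * (norm (\<Delta>2 n))\<^sup>2 \<le> \<beta>\<^sup>2 / (\<gamma> n * (2 * \<beta> - \<gamma> n)) * (norm (\<Delta>2 n))\<^sup>2"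
      by (intro mult_right_mono) auto
    moreover have "2 * \<beta> * deviation n
        = (norm (\<Delta>1 n))\<^sup>2 + \<beta>\<^sup>2 / (\<gamma> n * (2 * \<beta> - \<gamma> n)) * (norm (\<Delta>2 n))\<^sup>2"
      using \<beta>_pos by (simp add: deviation_def distrib_left power2_eq_square)
    ultimately show "(norm (\<Delta>1 n))\<^sup>2 \<le> 2 * \<beta> * deviation n"
      "(norm (\<Delta>2 n))\<^sup>2 \<le> 2 * \<beta> * deviation n"
      using zero_le_power2[of "norm (\<Delta>1 n)"] zero_le_power2[of "norm (\<Delta>2 n)"] by linarith+
  qed
  then show "summable (\<lambda>n. (norm (\<Delta>1 n))\<^sup>2)" "summable (\<lambda>n. (norm (\<Delta>2 n))\<^sup>2)"
    by (auto intro: summable_comparison_test'[OF dev])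
qed

lemma summable_steps: "summable (\<lambda>n. (norm (x n - x (Suc n)))\<^sup>2)"
proof (rule summable_comparison_test_ev)
  \<comment> \<open>The factors 2 come from bounding the square of a sum of two norms.
    \<open>4 * \<beta>\<^sup>2 / \<delta>\<close> bounds the reciprocal of the coefficient in
    \<open>prox_gap\<close>, and \<open>\<beta> / \<delta>\<close> bounds the shift factor of
    \<open>\<Delta>2 n\<close>.\<close>
  define B where "B = 2 * (4 * \<beta>\<^sup>2 / \<delta>)"
  define C where "C = 2 * (\<beta> / \<delta>)\<^sup>2"
  show "summable (\<lambda>n. B * (prox_gap n + grad_gap n) + C * (norm (\<Delta>2 n))\<^sup>2)"
    by (intro summable_add summable_mult summable_gaps summable_deviations)
  show "\<forall>\<^sub>F n in sequentially. norm ((norm (x n - x (Suc n)))\<^sup>2)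
      \<le> B * (prox_gap n + grad_gap n) + C * (norm (\<Delta>2 n))\<^sup>2"
    using ev_\<gamma>
  proof eventually_elim
    case (elim n)
    define c where "c = \<beta> / (2 * \<beta> - \<gamma> n)"
    define v where "v = x (Suc n) - x n - c *\<^sub>R \<Delta>2 n"
    have "norm (x n - x (Suc n)) = norm (v + c *\<^sub>R \<Delta>2 n)" by (simp add: v_def norm_minus_commute)
    also have "\<dots> \<le> norm v + norm (c *\<^sub>R \<Delta>2 n)" by (rule norm_triangle_ineq)
    finally have "(norm (x n - x (Suc n)))\<^sup>2 \<le> (norm v + norm (c *\<^sub>R \<Delta>2 n))\<^sup>2" by (simp add: power_mono)
    also have "\<dots> \<le> 2 * (norm v)\<^sup>2 + 2 * (norm (c *\<^sub>R \<Delta>2 n))\<^sup>2"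
      using zero_le_power2[of "norm v - norm (c *\<^sub>R \<Delta>2 n)"]
      by (simp add: power2_eq_square algebra_simps)
    also have "2 * (norm (c *\<^sub>R \<Delta>2 n))\<^sup>2 \<le> C * (norm (\<Delta>2 n))\<^sup>2"
    proof -
      have "0 \<le> c" "c \<le> \<beta> / \<delta>"
        using elim \<delta> \<beta>_pos \<gamma>_less[of n] by (auto simp: c_def intro!: divide_left_mono)
      then have "c\<^sup>2 \<le> (\<beta> / \<delta>)\<^sup>2" by (simp add: power_mono)
      then have "2 * c\<^sup>2 * (norm (\<Delta>2 n))\<^sup>2 \<le> C * (norm (\<Delta>2 n))\<^sup>2"
        unfolding C_def by (intro mult_right_mono) auto
      then show ?thesis by (simp add: power_mult_distrib)
    qed
    also have "2 * (norm v)\<^sup>2 \<le> B * prox_gap n"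
    proof -
      have "\<delta> \<le> 2 * \<beta> - \<gamma> n" "2 * \<beta> * \<gamma> n \<le> 4 * \<beta>\<^sup>2" "0 < 2 * \<beta> * \<gamma> n"
        using elim \<beta>_pos \<gamma>_less[of n] \<gamma>_pos[of n] mult_left_mono[of "\<gamma> n" "2 * \<beta>" "2 * \<beta>"]
        by (simp_all add: power2_eq_square)
      then have "\<delta> / (4 * \<beta>\<^sup>2) \<le> (2 * \<beta> - \<gamma> n) / (2 * \<beta> * \<gamma> n)"
        using \<delta> by (intro frac_le) auto
      then have "\<delta> / (4 * \<beta>\<^sup>2) * (norm v)\<^sup>2 \<le> prox_gap n"
        unfolding prox_gap_def v_def c_def by (rule mult_right_mono) simp
      then have "B * (\<delta> / (4 * \<beta>\<^sup>2) * (norm v)\<^sup>2) \<le> B * prox_gap n"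
        using \<delta> by (intro mult_left_mono) (auto simp: B_def)
      then show ?thesis using \<delta> \<beta>_pos by (simp add: B_def)
    qed
    also have "B * prox_gap n \<le> B * (prox_gap n + grad_gap n)"
      using gaps_nonneg \<delta> by (intro mult_left_mono) (auto simp: B_def)
    finally show ?case by simp
  qed
qed

end

section \<open>Vanishing subgradients and weak cluster points\<close>

definition residual :: "nat \<Rightarrow> 'a" where
  "residual n = (1 / \<gamma> n) *\<^sub>R (prox_arg n - x (Suc n)) + gradf (x (Suc n))"

text \<open>\<open>residual n\<close> adds the subgradient of \<open>g\<close> supplied by the
  proximal step to the gradient of \<open>f\<close> at the same point, so the two subgradient
  inequalities add up.\<close>

lemma objective_subgradient:
  assumes "g y \<le> ereal s"
  shows "f (x (Suc n)) + gval n + residual n \<bullet> (y - x (Suc n)) \<le> f y + s"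
  using g_subgradient[OF assms, of n]
    convex_gradient_inequality[OF f_convex f_grad, of "x (Suc n)" y]
  by (simp add: residual_def inner_add_left)

lemma residual_tendsto_0:
  assumes "summable (\<lambda>n. (norm (x n - x (Suc n)))\<^sup>2)"
    "summable (\<lambda>n. (norm (\<Delta>1 n))\<^sup>2)" "summable (\<lambda>n. (norm (\<Delta>2 n))\<^sup>2)"
    and c: "c > 0" "\<forall>\<^sub>F n in sequentially. c \<le> \<gamma> n"
  shows "(\<lambda>n. norm (residual n)) \<longlonglongrightarrow> 0"
proof -
  have null: "(\<lambda>n. norm (v n)) \<longlonglongrightarrow> 0" if "summable (\<lambda>n. (norm (v n))\<^sup>2)" for v :: "nat \<Rightarrow> 'a"
  proof -
    have "(\<lambda>n. sqrt ((norm (v n))\<^sup>2)) \<longlonglongrightarrow> sqrt 0"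
      by (intro tendsto_real_sqrt summable_LIMSEQ_zero that)
    then show ?thesis by simp
  qed
  define s where "s n = norm (x n - x (Suc n))" for n
  define U where "U n = 1 / c * s n + 1 / \<beta> * (s n + norm (\<Delta>1 n)) + 1 / \<beta> * norm (\<Delta>1 n)
    + 1 / c * norm (\<Delta>2 n)" for n
  have "U \<longlonglongrightarrow> 1 / c * 0 + 1 / \<beta> * (0 + 0) + 1 / \<beta> * 0 + 1 / c * 0"
    unfolding U_def s_def by (intro tendsto_add tendsto_mult tendsto_const null assms)
  then have U: "U \<longlonglongrightarrow> 0" by simp
  show ?thesis
  proof (rule tendsto_sandwich[OF _ _ tendsto_const U])
    show "\<forall>\<^sub>F n in sequentially. norm (residual n) \<le> U n"
      using c(2)
    proof eventually_elim
      case (elim n)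
      \<comment> \<open>The gradient at \<open>w n\<close> inside \<open>prox_arg n\<close> pairs
        with the gradient at \<open>x (Suc n)\<close>, and the Lipschitz bound controls their
        difference. The four summands match those of \<open>U n\<close>.\<close>
      have eq: "residual n = (1 / \<gamma> n) *\<^sub>R (x n - x (Suc n)) + (gradf (x (Suc n)) - gradf (w n))
          + (1 / \<beta>) *\<^sub>R \<Delta>1 n + (1 / \<gamma> n) *\<^sub>R \<Delta>2 n"
        using \<gamma>_pos[of n] by (simp add: residual_def prox_arg_def algebra_simps)
      have inv: "1 / \<gamma> n \<le> 1 / c" using elim c(1) by (simp add: frac_le)
      have 1: "norm ((1 / \<gamma> n) *\<^sub>R (x n - x (Suc n))) \<le> 1 / c * s n"
        using mult_right_mono[OF inv norm_ge_zero] \<gamma>_pos[of n] by (simp add: s_def)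
      have 2: "norm ((1 / \<gamma> n) *\<^sub>R \<Delta>2 n) \<le> 1 / c * norm (\<Delta>2 n)"
        using mult_right_mono[OF inv norm_ge_zero] \<gamma>_pos[of n] by simp
      have "norm (x (Suc n) - w n) \<le> s n + norm (\<Delta>1 n)"
        using norm_triangle_ineq4[of "x (Suc n) - x n" "\<Delta>1 n"] w_def
        by (simp add: s_def norm_minus_commute[of "x n"] diff_diff_eq)
      then have "1 / \<beta> * norm (x (Suc n) - w n) \<le> 1 / \<beta> * (s n + norm (\<Delta>1 n))"
        using \<beta>_pos by (intro mult_left_mono) auto
      then have 3: "norm (gradf (x (Suc n)) - gradf (w n)) \<le> 1 / \<beta> * (s n + norm (\<Delta>1 n))"
        using lipschitz_onD[OF gradf_lipschitz, of "x (Suc n)" "w n"]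
        by (simp add: dist_norm inverse_eq_divide)
      have 4: "norm ((1 / \<beta>) *\<^sub>R \<Delta>1 n) = 1 / \<beta> * norm (\<Delta>1 n)" using \<beta>_pos by simp
      show ?case unfolding eq U_def
        by (intro norm_triangle_le add_mono 1 2 3 eq_refl[OF 4])
    qed
  qed auto
qed

text \<open>
  A weakly convergent subsequence is bounded, so the vanishing residual makes it eventually enter
  the sublevel set of \<open>f + g\<close> at any height above \<open>f y + g y\<close>; such sets are weakly closed.
\<close>

lemma weak_cluster_point_minimizes:
  assumes res: "(\<lambda>n. norm (residual n)) \<longlonglongrightarrow> 0" and z: "weak_seq_cluster_point x z"
  shows "minimizer (\<lambda>v. ereal (f v) + g v) z"
proof -
  obtain r where r: "strict_mono r" "weakly_converges (x \<circ> r) z"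
    using z by (auto simp: weak_seq_cluster_point_def)
  obtain M where M: "\<And>k. norm ((x \<circ> r) k) \<le> M" using weakly_converges_imp_bounded[OF r(2)] by blast
  \<comment> \<open>Subgradients are available only at iterates of positive index, so the
    subsequence is used from \<open>k = 1\<close> on, where \<open>r k\<close> is at least
    \<open>k\<close>.\<close>
  have r1: "\<forall>\<^sub>F k in sequentially. r k = Suc (r k - 1)"
    using eventually_ge_at_top[of 1]
  proof eventually_elim
    case (elim k)
    then show ?case using seq_suble[OF r(1), of k] by simp
  qed
  have "filterlim (\<lambda>k. r k - 1) at_top sequentially"
    by (rule filterlim_compose[OF filterlim_minus_const_nat_at_top filterlim_subseq[OF r(1)]])
  then have res_r: "(\<lambda>k. norm (residual (r k - 1))) \<longlonglongrightarrow> 0" by (rule filterlim_compose[OF res])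
  have cont: "continuous_on UNIV f"
    using f_grad has_derivative_continuous
    by (metis gderiv_def continuous_at_imp_continuous_on)
  have "ereal (f z) + g z \<le> ereal (f y) + g y" for y
  proof (cases "g y")
    case (real s)
    have "ereal (f z) + g z \<le> ereal (f y + s) + ereal \<epsilon>" if \<epsilon>: "\<epsilon> > 0" for \<epsilon>
    proof -
      define C where "C = {v. g v \<le> ereal (f y + s + \<epsilon> - f v)}"
      \<comment> \<open>The weakly convergent subsequence is bounded by \<open>M\<close>, so
        \<open>norm y + M\<close> bounds its distances to \<open>y\<close>; by Cauchy-Schwarz the
        linear term in \<open>objective_subgradient\<close> is eventually above
        \<open>- \<epsilon>\<close>.\<close>
      have "(\<lambda>k. norm (residual (r k - 1)) * (norm y + M)) \<longlonglongrightarrow> 0 * (norm y + M)"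
        by (intro tendsto_mult res_r tendsto_const)
      then have "\<forall>\<^sub>F k in sequentially. norm (residual (r k - 1)) * (norm y + M) < \<epsilon>"
        using \<epsilon> by (intro order_tendstoD) auto
      then have "\<forall>\<^sub>F k in sequentially. (x \<circ> r) k \<in> C" using r1
      proof eventually_elim
        case (elim k)
        define n where "n = r k - 1"
        have n: "r k = Suc n" using elim by (simp add: n_def)
        have "norm (y - x (Suc n)) \<le> norm y + M"
          using norm_triangle_ineq4[of y "x (Suc n)"] M[of k] n by simp
        then have "norm (residual n) * norm (y - x (Suc n)) < \<epsilon>"
          using elim mult_left_mono[of "norm (y - x (Suc n))" "norm y + M" "norm (residual n)"]
          by (simp add: n_def)
        then have "- \<epsilon> < residual n \<bullet> (y - x (Suc n))"
          using Cauchy_Schwarz_ineq2[of "residual n" "y - x (Suc n)"] by linarith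
        moreover have "f (x (Suc n)) + gval n + residual n \<bullet> (y - x (Suc n)) \<le> f y + s"
          by (rule objective_subgradient) (simp add: real)
        ultimately show ?case by (simp add: C_def n g_iterate)
      qed
      then have "z \<in> C"
        using closed_convex_sublevel[OF f_convex cont g_convex g_lsc]
        unfolding C_def by (intro weakly_converges_mem_closed_convex[OF _ _ r(2)]) auto
      then show ?thesis by (cases "g z") (auto simp: C_def)
    qed
    then have "ereal (f z) + g z \<le> ereal (f y + s)" by (rule ereal_le_epsilon2)
    then show ?thesis by (simp add: real)
  qed (use g_proper in \<open>auto simp: proper_fun_def\<close>)
  then show ?thesis by (auto simp: is_arg_min_def not_less)
qed

end

section \<open>Assembly of the three items\<close>

theorem theorem3p2:
  fixes f :: "'a::{real_inner, complete_space} \<Rightarrow> real"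
    and gradf :: "'a \<Rightarrow> 'a"
    and g :: "'a \<Rightarrow> ereal"
    and \<beta> :: real
    and \<gamma> \<alpha>1 \<alpha>2 :: "nat \<Rightarrow> real"
    and x w \<Delta>1 \<Delta>2 :: "nat \<Rightarrow> 'a"
  assumes f_convex: "convex_on UNIV f"
    and f_grad: "\<forall>z. GDERIV f z :> gradf z"
    and \<beta>_pos: "\<beta> > 0"
    and gradf_lipschitz: "(inverse \<beta>)-lipschitz_on UNIV gradf"
    and g_proper: "proper_fun g"
    and g_convex: "convex_fun g"
    and g_lsc: "lsc_fun g"
    and \<gamma>_range: "\<forall>n. 0 < \<gamma> n \<and> \<gamma> n < 2 * \<beta>"
    and w_def: "\<forall>n. w n = x n + \<Delta>1 n"
    and x_step: "\<forall>n. x (Suc n) =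
      prox (\<gamma> n) g (x n - \<gamma> n *\<^sub>R gradf (w n) + (\<gamma> n / \<beta>) *\<^sub>R \<Delta>1 n + \<Delta>2 n)"
    and deviation_bound: "\<forall>n\<ge>1.
      1 / (2 * \<beta>) * (norm (\<Delta>1 n))\<^sup>2
        + \<beta> / (2 * \<gamma> n * (2 * \<beta> - \<gamma> n)) * (norm (\<Delta>2 n))\<^sup>2
      \<le> \<alpha>1 n * (2 * \<beta> - \<gamma> (n - 1)) / (2 * \<beta> * \<gamma> (n - 1))
          * (norm (x n - x (n - 1) - (\<beta> / (2 * \<beta> - \<gamma> (n - 1))) *\<^sub>R \<Delta>2 (n - 1)))\<^sup>2
        + \<beta> * \<alpha>2 n / 2
          * (norm (gradf (w n) - gradf (w (n - 1)) - (1 / \<beta>) *\<^sub>R (x n - w (n - 1))))\<^sup>2"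
  defines "V \<equiv> lyapunov \<beta> f gradf g x w"
    and "F \<equiv> (\<lambda>z. ereal (f z) + g z)"
    and "standing \<equiv>
      (\<exists>m::real. \<forall>z. ereal m \<le> ereal (f z) + g z)
      \<and> 0 < liminf (\<lambda>n. ereal (\<gamma> n))
      \<and> liminf (\<lambda>n. ereal (\<gamma> n)) \<le> limsup (\<lambda>n. ereal (\<gamma> n))
      \<and> limsup (\<lambda>n. ereal (\<gamma> n)) < ereal (2 * \<beta>)
      \<and> 0 \<le> limsup (\<lambda>n. ereal (\<alpha>1 n)) \<and> limsup (\<lambda>n. ereal (\<alpha>1 n)) < 1
      \<and> 0 \<le> limsup (\<lambda>n. ereal (\<alpha>2 n)) \<and> limsup (\<lambda>n. ereal (\<alpha>2 n)) < 1"
  shows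
    "((\<forall>n. F (x (Suc n)) \<le> V n)
      \<and> ((\<forall>n. \<alpha>1 n \<le> 1 \<and> \<alpha>2 n \<le> 1) \<longrightarrow>
          decseq (\<lambda>n. V n + ereal ((2 * \<beta> - \<gamma> n) / (2 * \<beta> * \<gamma> n)
            * (norm (x (Suc n) - x n - (\<beta> / (2 * \<beta> - \<gamma> n)) *\<^sub>R \<Delta>2 n))\<^sup>2))))
     \<and> (standing \<longrightarrow>
          summable (\<lambda>n. (norm (x n - x (Suc n)))\<^sup>2)
          \<and> summable (\<lambda>n. (norm (\<Delta>1 n))\<^sup>2)
          \<and> summable (\<lambda>n. (norm (\<Delta>2 n))\<^sup>2))
     \<and> (standing \<longrightarrow> (\<forall>z. weak_seq_cluster_point x z \<longrightarrow> minimizer F z))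
     \<and> (standing \<longrightarrow> (\<nexists>z. minimizer F z) \<longrightarrow> filterlim (\<lambda>n. norm (x n)) at_top sequentially)
     \<and> (bounded (range x) \<longrightarrow> (\<exists>z. weak_seq_cluster_point x z))"
proof -
  interpret forward_backward_deviations f gradf g \<beta> \<gamma> \<alpha>1 \<alpha>2 x w \<Delta>1 \<Delta>2
    by unfold_locales fact+
  have item1: "F (x (Suc n)) \<le> V n" for n
    using objective_le_lyap[of n] by (simp add: F_def V_def lyapunov_eq g_iterate)
  have item1': "decseq (\<lambda>n. V n + ereal ((2 * \<beta> - \<gamma> n) / (2 * \<beta> * \<gamma> n)
            * (norm (x (Suc n) - x n - (\<beta> / (2 * \<beta> - \<gamma> n)) *\<^sub>R \<Delta>2 n))\<^sup>2))"
    if "\<forall>n. \<alpha>1 n \<le> 1 \<and> \<alpha>2 n \<le> 1"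
    unfolding V_def lyapunov_eq prox_gap_def[symmetric]
    by (intro decseq_SucI) (use that lyap_decreasing in simp)
  have summ: "summable (\<lambda>n. (norm (x n - x (Suc n)))\<^sup>2)"
    "summable (\<lambda>n. (norm (\<Delta>1 n))\<^sup>2)" "summable (\<lambda>n. (norm (\<Delta>2 n))\<^sup>2)"
    and res: "(\<lambda>n. norm (residual n)) \<longlonglongrightarrow> 0"
    if standing
  proof -
    obtain m where m: "\<And>z. ereal m \<le> ereal (f z) + g z"
      using \<open>standing\<close> by (auto simp: standing_def)
    \<comment> \<open>Reals strictly between the limits and their bounds turn the liminf and limsup
      conditions into eventual inequalities with uniform constants.\<close>
    obtain b1 where b1: "limsup (\<lambda>n. ereal (\<alpha>1 n)) < ereal b1" "ereal b1 < 1"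
      using \<open>standing\<close> by (metis standing_def ereal_dense2)
    obtain b2 where b2: "limsup (\<lambda>n. ereal (\<alpha>2 n)) < ereal b2" "ereal b2 < 1"
      using \<open>standing\<close> by (metis standing_def ereal_dense2)
    obtain c where c: "0 < ereal c" "ereal c < liminf (\<lambda>n. ereal (\<gamma> n))"
      using \<open>standing\<close> by (metis standing_def ereal_dense2)
    obtain d where d: "limsup (\<lambda>n. ereal (\<gamma> n)) < ereal d" "ereal d < ereal (2 * \<beta>)"
      using \<open>standing\<close> by (metis standing_def ereal_dense2)
    have \<alpha>: "\<forall>\<^sub>F n in sequentially. \<alpha>1 n \<le> max b1 b2 \<and> \<alpha>2 n \<le> max b1 b2"
      using Limsup_lessD[OF b1(1)] Limsup_lessD[OF b2(1)] by eventually_elim auto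
    \<comment> \<open>The bound \<open>d\<close> is written so as to exhibit the margin
      \<open>2 * \<beta> - d\<close>, which plays the part of \<open>\<delta>\<close>.\<close>
    have \<gamma>: "\<forall>\<^sub>F n in sequentially. \<gamma> n \<le> 2 * \<beta> - (2 * \<beta> - d)"
      using Limsup_lessD[OF d(1)] by eventually_elim simp
    have c': "\<forall>\<^sub>F n in sequentially. c \<le> \<gamma> n"
      using less_LiminfD[OF c(2)] by eventually_elim simp
    have pos: "max b1 b2 < 1" "2 * \<beta> - d > 0" "c > 0"
      using b1(2) b2(2) d(2) c(1) by auto
    note * = m pos(1,2) \<alpha> \<gamma>
    show "summable (\<lambda>n. (norm (x n - x (Suc n)))\<^sup>2)"
      "summable (\<lambda>n. (norm (\<Delta>1 n))\<^sup>2)" "summable (\<lambda>n. (norm (\<Delta>2 n))\<^sup>2)"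
      by (rule summable_steps[OF *] summable_deviations[OF *])+
    then show "(\<lambda>n. norm (residual n)) \<longlonglongrightarrow> 0"
      by (rule residual_tendsto_0[OF _ _ _ pos(3) c'])
  qed
  have cluster: "minimizer F z" if standing "weak_seq_cluster_point x z" for z
    using weak_cluster_point_minimizes[OF res that(2)] that(1) by (simp add: F_def)
  have diverge: "filterlim (\<lambda>n. norm (x n)) at_top sequentially"
    if standing "\<nexists>z. minimizer F z"
    using cluster that by (intro norm_at_top_if_no_weak_cluster_point) blast
  have exists: "\<exists>z. weak_seq_cluster_point x z" if "bounded (range x)"
    using bounded_imp_weak_seq_cluster_point[OF that] by blast
  show ?thesis
    by (intro conjI allI impI; (rule item1 | (rule item1' summ cluster diverge exists; assumption)))
qed

end
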